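(* For every integer $n\ge 1$: if $q_n>n$, then $|q_n-n\phi|<\dfrac{5}{\phi}$; and if $q_n<n$, then $\left|q_n-\dfrac{n}{\phi}\right|<4+\dfrac{5}{\phi}$.
   Context: $\mathbb N=\{0,1,2,\dots\}$. $\phi=(1+\sqrt5)/2$. The greedy queens sequence $(q_n)_{n\ge0}$ is defined by $q_0=0$ and, for $n\ge1$, $q_n$ is the least $y\in\mathbb N$ such that for all $0\le i<n$: $y\ne q_i$, $y-n\ne q_i-i$, and $y+n\ne q_i+i$. (Each step excludes only finitely many $y$, so $q_n$ is well defined.) *)

theory Defs
  imports Complex_Main
begin

definition golden_ratio :: real where
  "golden_ratio = (1 + sqrt 5) / 2"

text \<open>
  The candidate \<open>y\<close> ranges over \<open>nat\<close>, but the differences \<open>y - n\<close> may be negative and are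
  therefore compared in \<open>int\<close>.
\<close>

function greedy_queens :: "nat \<Rightarrow> nat" where
  "greedy_queens n =
     (if n = 0 then 0
      else (LEAST y::nat. \<forall>i\<in>{0..<n}.
              y \<noteq> greedy_queens i \<and>
              int y - int n \<noteq> int (greedy_queens i) - int i \<and>
              y + n \<noteq> greedy_queens i + i))"
  by auto
termination
  by (relation "measure (\<lambda>n. n)") auto

declare greedy_queens.simps [simp del]

text \<open>The minimum is always taken over a nonempty set.\<close>

lemma greedy_queens_candidate_exists:
  fixes n :: nat
  shows "\<exists>y::nat. \<forall>i\<in>{0..<n}.
           y \<noteq> greedy_queens i \<and>
           int y - int n \<noteq> int (greedy_queens i) - int i \<and>
           y + n \<noteq> greedy_queens i + i"
proof -
  define y where "y = Suc (n + (\<Sum>i\<in>{0..<n}. greedy_queens i + i))"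
  have "greedy_queens i + i + n < y" if "i \<in> {0..<n}" for i
    using member_le_sum[of i "{0..<n}" "\<lambda>i. greedy_queens i + i"] that
    by (simp add: y_def)
  then show ?thesis
    by (intro exI[of _ y] ballI) force
qed

end

theory Submission
  imports Defs
begin

text \<open>
  Call column \<open>n\<close> upper if \<open>q n > n\<close>. The upper queens occupy the diagonals above the main
  one in order: the \<open>k\<close>-th of them, in column \<open>n\<close>, stands in row \<open>n + k\<close>
  (\<open>queen_trichotomy\<close>). So the first claim compares \<open>k\<close> with \<open>n / \<phi>\<close>, and all depends on the
  number \<open>uppers n\<close> of upper columns before \<open>n\<close>.

  The lower queens fill the rows that the upper queens leave free, and the diagonals below
  the main one, almost in order. Suppose that before column \<open>n\<close> the rows below \<open>m\<close> and the
  diagonals below \<open>d\<close> are full, with few occupied ones beyond. Counting the lower queens by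
  diagonals and by rows gives \<open>uppers n = m + v\<close> and \<open>n - uppers n = m - j + r\<close>, where \<open>v\<close>
  is \<open>n - m - d\<close> minus the number of exceptional diagonals, \<open>r\<close> is the number of exceptional
  rows, and \<open>j\<close> is the number of upper queens in rows below \<open>m\<close> (\<open>excess_eq\<close>, \<open>spare_eq\<close>).
  These \<open>j\<close> queens stand in columns up to about \<open>n / \<phi>\<^sup>2\<close>. Eliminating \<open>m\<close> bounds the
  deviation from \<open>n / \<phi>\<close> at column \<open>n\<close> by the deviation at such an earlier column, divided
  by \<open>\<phi>\<^sup>2\<close>, plus a term in \<open>v\<close> and \<open>r\<close> (\<open>contraction_upper\<close>, \<open>contraction_lower\<close>). If \<open>v\<close>
  and \<open>r\<close> are bounded, so is the deviation, and the bounds that hold yield \<open>5 / \<phi>\<close>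
  (\<open>offset_bound\<close>). A lower queen is found within a distance between \<open>-3\<close> and \<open>4\<close> of row
  \<open>uppers n\<close>, which gives the second claim (\<open>lower_bound\<close>).

  It remains to see that the exceptional rows and diagonals stay few. This is not a matter
  of densities but of fine structure. The next lower queen is determined by the exceptional
  rows, diagonals and sums and by the natures, upper or not, of the rows and the columns
  just above position \<open>m\<close>. Thus the process is a machine that reads, at position \<open>m\<close>, a word
  whose letters are the pairs of these natures, and that writes the same word at a position
  near \<open>n\<close>, which is about \<open>\<phi> * m\<close> (\<open>advance_describes\<close>). If the word that it reads is
  admitted by a certain finite automaton, then it runs through finitely many states only,
  all of them with the required bounds, and the word that it writes is admitted by the
  automaton again; this is verified by exploring all states (\<open>search_finished\<close>). As the
  machine reads behind the place where it writes, induction shows that this is what happens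
  from column \<open>31\<close> on (\<open>all_controlled\<close>). Earlier columns are computed (\<open>first_queens_30\<close>).
\<close>

section \<open>Upper and lower queens\<close>

abbreviation q :: "nat \<Rightarrow> nat" where "q \<equiv> greedy_queens"

definition free :: "nat \<Rightarrow> nat \<Rightarrow> bool" where
  "free n y \<longleftrightarrow> (\<forall>i<n. y \<noteq> q i \<and> int y - int n \<noteq> int (q i) - int i \<and> y + n \<noteq> q i + i)"

lemma queen_0 [simp]: "q 0 = 0"
  by (simp add: greedy_queens.simps)

lemma queen_eq_Least: "n > 0 \<Longrightarrow> q n = (LEAST y. free n y)"
  by (subst greedy_queens.simps) (simp add: free_def[abs_def] Ball_def)

lemma ex_free: "\<exists>y. free n y"
  using greedy_queens_candidate_exists[of n] by (simp add: free_def Ball_def)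

lemma free_queen: "n > 0 \<Longrightarrow> free n (q n)"
  using ex_free[of n] by (auto simp: queen_eq_Least intro: LeastI_ex)

lemma not_free_below_queen: "n > 0 \<Longrightarrow> y < q n \<Longrightarrow> \<not> free n y"
  by (metis not_less_Least queen_eq_Least)

lemma queen_le: "n > 0 \<Longrightarrow> free n y \<Longrightarrow> q n \<le> y"
  using not_free_below_queen not_less by blast

lemma queens_do_not_attack:
  assumes "i < n"
  shows "q n \<noteq> q i" "int (q n) - int n \<noteq> int (q i) - int i" "q n + n \<noteq> q i + i"
  using free_queen[of n] assms unfolding free_def by auto

lemma inj_queen: "q i = q j \<Longrightarrow> i = j"
  using queens_do_not_attack(1) by (metis nat_neq_iff)

definition upper :: "nat \<Rightarrow> bool" where "upper n \<longleftrightarrow> n < q n"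

definition uppers :: "nat \<Rightarrow> nat" where "uppers n = card {a. a < n \<and> upper a}"

lemma upper_0 [simp]: "\<not> upper 0"
  by (simp add: upper_def)

lemma uppers_0 [simp]: "uppers 0 = 0"
  by (simp add: uppers_def)

lemma uppers_Suc [simp]: "uppers (Suc n) = uppers n + (if upper n then 1 else 0)"
proof -
  have "{a. a < Suc n \<and> upper a} = (if upper n then insert n {a. a < n \<and> upper a} else {a. a < n \<and> upper a})"
    using less_Suc_eq by auto
  then show ?thesis
    by (simp add: uppers_def)
qed

lemma uppers_mono: "a \<le> b \<Longrightarrow> uppers a \<le> uppers b"
  by (rule lift_Suc_mono_le) auto

lemma uppers_less: "a < b \<Longrightarrow> upper a \<Longrightarrow> uppers a < uppers b"
  using uppers_mono[of "Suc a" b] by simp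

lemma uppers_le: "uppers n \<le> n"
  by (induction n) auto

lemma ex_upper_rank: "k < uppers n \<Longrightarrow> \<exists>a<n. upper a \<and> uppers a = k"
proof (induction n)
  case (Suc n)
  then show ?case
    using less_Suc_eq by (cases "k < uppers n") (auto split: if_splits)
qed auto

text \<open>
  At or above the diagonal the choice is forced. The squares \<open>n, \<dots>, n + uppers n\<close> of column \<open>n\<close> lie on
  the difference diagonals \<open>0, \<dots>, uppers n\<close>, each of which carries an earlier queen, namely the
  queen of column \<open>0\<close> and, by induction, the earlier upper queens in their order. The next square up
  is free: earlier upper queens lie on lower diagonals, in lower rows and on smaller sums, and the
  remaining queens do not rise above the diagonal at all.
\<close>

lemma queen_trichotomy:
  assumes "n > 0"
  shows "q n < n \<or> q n = n + uppers n + 1"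
  using assms
proof (induction n rule: less_induct)
  case (less n)
  have row: "q a = a + uppers a + 1" if "upper a" "a < n" for a
    using less.IH[of a] that by (cases "a = 0") (auto simp: upper_def)
  have low: "q a \<le> a" if "\<not> upper a" for a
    using that by (simp add: upper_def)
  have blocked: "\<not> free n y" if "n \<le> y" "y < n + uppers n + 1" for y
  proof (cases "y = n")
    case True
    then show ?thesis
      using \<open>n > 0\<close> by (auto simp: free_def intro: exI[of _ 0])
  next
    case False
    then have "y - n - 1 < uppers n"
      using that by linarith
    then obtain a where a: "a < n" "upper a" "uppers a = y - n - 1"
      using ex_upper_rank by blast
    then have "int y - int n = int (q a) - int a"
      using row[of a] that False by auto
    then show ?thesis
      using a(1) by (auto simp: free_def)
  qed
  have "free n (n + uppers n + 1)"
    unfolding free_def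
  proof (intro allI impI)
    fix i assume "i < n"
    show "n + uppers n + 1 \<noteq> q i \<and> int (n + uppers n + 1) - int n \<noteq> int (q i) - int i
            \<and> n + uppers n + 1 + n \<noteq> q i + i"
      using \<open>i < n\<close> row[of i] low[of i] uppers_less[of i n] by (cases "upper i") auto
  qed
  then have "q n \<le> n + uppers n + 1"
    using queen_le less.prems by blast
  moreover have "\<not> (n \<le> q n \<and> q n < n + uppers n + 1)"
    using blocked free_queen less.prems by blast
  ultimately show ?case
    by linarith
qed

lemma upper_queen: "upper n \<Longrightarrow> q n = n + uppers n + 1"
  using queen_trichotomy[of n] by (cases "n = 0") (auto simp: upper_def)

lemma lower_queen: "\<not> upper n \<Longrightarrow> n > 0 \<Longrightarrow> q n < n"
  using queen_trichotomy[of n] by (auto simp: upper_def)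

lemma lower_queen_le: "\<not> upper n \<Longrightarrow> q n \<le> n"
  by (simp add: upper_def)

section \<open>The greedy rule below the diagonal\<close>

text \<open>
  Upper queens are collected without a bound on their column: in column \<open>n\<close> only squares \<open>y < n\<close> are in
  question, and an upper queen that attacks such a square along a row or an antidiagonal stands in a
  column before \<open>n\<close>. Hence \<open>upper_row\<close> and \<open>upper_sum\<close> do not depend on \<open>n\<close>.
\<close>

definition upper_row :: "nat \<Rightarrow> bool" where
  "upper_row r \<longleftrightarrow> (\<exists>a. upper a \<and> q a = r)"
definition lower_row :: "nat \<Rightarrow> nat \<Rightarrow> bool" where
  "lower_row n r \<longleftrightarrow> (\<exists>c<n. \<not> upper c \<and> q c = r)"
definition lower_diag :: "nat \<Rightarrow> nat \<Rightarrow> bool" where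
  "lower_diag n d \<longleftrightarrow> (\<exists>c<n. \<not> upper c \<and> q c + d = c)"
definition upper_sum :: "nat \<Rightarrow> bool" where
  "upper_sum z \<longleftrightarrow> (\<exists>a. upper a \<and> q a + a = z)"
definition lower_sum :: "nat \<Rightarrow> nat \<Rightarrow> bool" where
  "lower_sum n z \<longleftrightarrow> (\<exists>c<n. \<not> upper c \<and> q c + c = z)"

lemma free_iff:
  assumes "y < n"
  shows "free n y \<longleftrightarrow> \<not> upper_row y \<and> \<not> lower_row n y \<and> \<not> lower_diag n (n - y)
           \<and> \<not> upper_sum (n + y) \<and> \<not> lower_sum n (n + y)" (is "_ \<longleftrightarrow> ?R")
proof
  assume f: "free n y"
  have "\<not> upper_row y"
  proof
    assume "upper_row y"
    then obtain a where a: "upper a" "q a = y"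
      by (auto simp: upper_row_def)
    then have "a < n"
      using assms by (auto simp: upper_def)
    then show False
      using f a by (auto simp: free_def)
  qed
  moreover have "\<not> lower_row n y"
    using f by (auto simp: free_def lower_row_def)
  moreover have "\<not> lower_diag n (n - y)"
  proof
    assume "lower_diag n (n - y)"
    then obtain c where c: "c < n" "q c + (n - y) = c"
      by (auto simp: lower_diag_def)
    then have "int y - int n = int (q c) - int c"
      using assms by linarith
    then show False
      using f c(1) by (auto simp: free_def)
  qed
  moreover have "\<not> upper_sum (n + y)"
  proof
    assume "upper_sum (n + y)"
    then obtain a where a: "upper a" "q a + a = n + y"
      by (auto simp: upper_sum_def)
    then have "a < n"
      using assms by (auto simp: upper_def)
    then show False
      using f a by (auto simp: free_def)
  qed
  moreover have "\<not> lower_sum n (n + y)"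
    using f by (auto simp: free_def lower_sum_def)
  ultimately show ?R
    by blast
next
  assume R: ?R
  show "free n y"
    unfolding free_def
  proof (intro allI impI)
    fix i assume i: "i < n"
    show "y \<noteq> q i \<and> int y - int n \<noteq> int (q i) - int i \<and> y + n \<noteq> q i + i"
    proof (cases "upper i")
      case True
      then show ?thesis
        using R assms by (auto simp: upper_row_def upper_sum_def upper_def add.commute)
    next
      case False
      have "int y - int n \<noteq> int (q i) - int i"
      proof
        assume "int y - int n = int (q i) - int i"
        then have "q i + (n - y) = i"
          using assms by linarith
        then show False
          using R i False by (auto simp: lower_diag_def)
      qed
      then show ?thesis
        using R i False by (auto simp: lower_row_def lower_sum_def add.commute)
    qed
  qed
qed

lemma upper_iff: "n > 0 \<Longrightarrow> upper n \<longleftrightarrow> (\<forall>y<n. \<not> free n y)"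
  by (meson free_queen lower_queen not_free_below_queen order_less_trans upper_def)

lemma lower_queen_eqI:
  assumes "y < n" "free n y" "\<And>x. x < y \<Longrightarrow> \<not> free n x"
  shows "\<not> upper n" "q n = y"
proof -
  have "q n \<le> y"
    using queen_le assms by force
  then show "q n = y"
    using assms(3) free_queen[of n] assms(1) by (metis gr_implies_not_zero le_neq_implies_less zero_less_iff_neq_zero)
  then show "\<not> upper n"
    using assms(1) by (simp add: upper_def)
qed

lemma upper_row_iff: "upper_row r \<longleftrightarrow> (\<exists>a. upper a \<and> r = a + uppers a + 1)"
  unfolding upper_row_def using upper_queen by auto

lemma upper_sum_iff: "upper_sum z \<longleftrightarrow> (\<exists>a. upper a \<and> z = 2 * a + uppers a + 1)"
  unfolding upper_sum_def using upper_queen by auto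

lemma upper_row_at: "upper a \<Longrightarrow> upper_row (a + uppers a + 1)"
  by (auto simp: upper_row_iff)

text \<open>
  Column \<open>a\<close> advances the rows whose nature is decided from \<open>a + uppers a\<close> on: the first of them is never
  an upper row, and an upper column adds one more row, which is.
\<close>

lemma no_upper_row_at: "\<not> upper_row (a + uppers a)"
proof
  assume "upper_row (a + uppers a)"
  then obtain b where b: "upper b" "a + uppers a = b + uppers b + 1"
    by (auto simp: upper_row_iff)
  then show False
    using uppers_less[of b a] uppers_mono[of a b] by (cases "b < a") auto
qed

section \<open>Columns and rows as an infinite word\<close>

type_synonym letter = "bool \<times> bool"

text \<open>
  The lower queens are governed by two binary sequences, the nature of column \<open>x\<close> and the nature of row
  \<open>x\<close>. They are read together, as one infinite word.
\<close>

definition tape :: "nat \<Rightarrow> letter" where "tape x = (upper x, upper_row x)"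

abbreviation tape_word :: "nat \<Rightarrow> nat \<Rightarrow> letter list" where
  "tape_word x k \<equiv> map tape [x..<x + k]"

lemma tape_word_Cons: "(c # w = tape_word x k) \<longleftrightarrow> (\<exists>k'. k = Suc k' \<and> c = tape x \<and> w = tape_word (Suc x) k')"
  by (cases k) (auto simp: upt_rec)

lemma all_from_Suc: "(\<forall>j. i \<le> j \<and> j < k \<longrightarrow> P j) \<longleftrightarrow> (i < k \<longrightarrow> P i) \<and> (\<forall>j. Suc i \<le> j \<and> j < k \<longrightarrow> P j)"
  for i k :: nat
  by (metis Suc_leD Suc_leI le_neq_implies_less order_refl)

text \<open>
  An upper queen in column \<open>a\<close> has coordinate sum \<open>2 * a + uppers a + 1\<close>. For a word that starts at
  position \<open>x\<close>, the number \<open>z\<close> is the excess of the sum in question over \<open>2 * x + uppers x\<close>; passing a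
  column lowers it by two, and passing an upper column by one more. The value \<open>None\<close> means that the
  word ends before the question is settled.
\<close>

fun attacked :: "int \<Rightarrow> letter list \<Rightarrow> bool option" where
  "attacked z [] = (if z \<le> 0 then Some False else None)"
| "attacked z ((a, b) # w) =
     (if z \<le> 0 then Some False
      else if a then (if z = 1 then Some True else attacked (z - 3) w)
      else attacked (z - 2) w)"

lemma attacked_correct:
  assumes "w = tape_word x (length w)" "attacked z w = Some b"
  shows "b \<longleftrightarrow> (\<exists>a\<ge>x. upper a \<and> int (2 * a + uppers a + 1) = int (2 * x + uppers x) + z)"
  using assms
proof (induction z w arbitrary: x rule: attacked.induct)
  case (1 z)
  have "int (2 * a + uppers a + 1) > int (2 * x + uppers x)" if "a \<ge> x" for a
    using uppers_mono[OF that] that by simp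
  then show ?case
    using 1 by (force split: if_splits)
next
  case (2 z c b' w)
  have gt: "int (2 * a + uppers a + 1) > int (2 * x + uppers x)" if "a \<ge> x" for a
    using uppers_mono[OF that] that by simp
  have c: "c = upper x" and w: "w = tape_word (Suc x) (length w)"
    using "2.prems"(1) unfolding tape_word_Cons by (auto simp: tape_def)
  have split: "(\<exists>a\<ge>x. P a) \<longleftrightarrow> P x \<or> (\<exists>a\<ge>Suc x. P a)" for P
    by (metis Suc_leD le_refl not_less_eq_eq order_antisym)
  show ?case
  proof (cases "z \<le> 0")
    case True
    then show ?thesis
      using "2.prems"(2) gt by (force)
  next
    case z: False
    show ?thesis
    proof (cases c)
      case True
      show ?thesis
      proof (cases "z = 1")
        case True
        then show ?thesis
          using "2.prems"(2) \<open>c\<close> c by auto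
      next
        case False
        then have "b \<longleftrightarrow> (\<exists>a\<ge>Suc x. upper a \<and>
            int (2 * a + uppers a + 1) = int (2 * Suc x + uppers (Suc x)) + (z - 3))"
          using "2.IH"(1)[OF z \<open>c\<close> False w] "2.prems"(2) \<open>c\<close> z by simp
        then show ?thesis
          using split[of "\<lambda>a. upper a \<and> int (2 * a + uppers a + 1) = int (2 * x + uppers x) + z"] False \<open>c\<close> c
          by (simp add: algebra_simps)
      qed
    next
      case False
      then have "b \<longleftrightarrow> (\<exists>a\<ge>Suc x. upper a \<and>
          int (2 * a + uppers a + 1) = int (2 * Suc x + uppers (Suc x)) + (z - 2))"
        using "2.IH"(2)[OF z False w] "2.prems"(2) z by simp
      then show ?thesis
        using split[of "\<lambda>a. upper a \<and> int (2 * a + uppers a + 1) = int (2 * x + uppers x) + z"] False c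
        by (simp add: algebra_simps)
    qed
  qed
qed

text \<open>
  The tape to the left of \<open>x\<close> need not be remembered, because upper queens there reach an excess of at
  most \<open>-2\<close>.
\<close>

lemma no_attack_from_before:
  assumes "upper a" "a < x" "z \<ge> -1"
  shows "int (2 * a + uppers a + 1) \<noteq> int (2 * x + uppers x) + z"
  using uppers_less[OF assms(2,1)] assms by linarith

lemma attacked_iff:
  assumes "w = tape_word x (length w)" "attacked z w = Some b" "z \<ge> -1"
    and "int k = int (2 * x + uppers x) + z"
  shows "b \<longleftrightarrow> upper_sum k"
proof -
  have "upper_sum k \<longleftrightarrow> (\<exists>a. upper a \<and> int (2 * a + uppers a + 1) = int (2 * x + uppers x) + z)"
    unfolding upper_sum_iff assms(4)[symmetric] by (metis of_nat_eq_iff)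
  also have "\<dots> \<longleftrightarrow> (\<exists>a\<ge>x. upper a \<and> int (2 * a + uppers a + 1) = int (2 * x + uppers x) + z)"
    using no_attack_from_before[OF _ _ assms(3)] not_less by blast
  finally show ?thesis
    using attacked_correct[OF assms(1,2)] by blast
qed

lemma upt_split: "i \<le> j \<Longrightarrow> j \<le> k \<Longrightarrow> [i..<k] = [i..<j] @ [j..<k]"
  using upt_add_eq_append[of i j "k - j"] by simp

text \<open>
  The rows of upper queens are the image of the columns under the substitution that sends an upper
  column to \<open>01\<close> and any other column to \<open>0\<close>.
\<close>

fun row_word :: "letter list \<Rightarrow> bool list" where
  "row_word [] = []"
| "row_word ((a, b) # w) = (if a then [False, True] else [False]) @ row_word w"

lemma row_word_correct:
  "row_word (tape_word x k) = map upper_row [x + uppers x..<x + k + uppers (x + k)]"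
proof (induction k arbitrary: x)
  case (Suc k)
  have len: "[x + uppers x..<x + Suc k + uppers (x + Suc k)] =
      [x + uppers x..<Suc x + uppers (Suc x)] @ [Suc x + uppers (Suc x)..<Suc x + k + uppers (Suc x + k)]"
    using upt_split[of "x + uppers x" "Suc x + uppers (Suc x)" "Suc x + k + uppers (Suc x + k)"]
      uppers_mono[of "Suc x" "Suc x + k"] by (simp del: upt_Suc)
  have "row_word (tape_word x (Suc k)) =
      (if upper x then [False, True] else [False]) @ row_word (tape_word (Suc x) k)"
    by (simp add: upt_rec tape_def)
  also have "(if upper x then [False, True] else [False]) = map upper_row [x + uppers x..<Suc x + uppers (Suc x)]"
    using no_upper_row_at[of x] upper_row_at[of x] by (auto simp: upt_rec)
  finally show ?case
    by (simp only: Suc.IH len map_append)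
qed auto

section \<open>The machine that places the lower queens\<close>

text \<open>
  A computation on a finite piece of the tape may need a longer piece (\<open>Read\<close>), may leave the range that
  is to be established (\<open>Bad\<close>), or may deliver a result.
\<close>

datatype 'a outcome = Read | Bad | Ok 'a

text \<open>
  The candidates for the next lower queen are numbered by their distance \<open>t\<close> from the first row \<open>m\<close>; the
  square at distance \<open>t\<close> lies at distance \<open>s - t\<close> from the first diagonal. The lists \<open>R\<close>, \<open>D\<close>, \<open>S\<close> hold the
  rows, diagonals and sums of earlier lower queens, measured in the same way, and \<open>g\<close> is the number
  \<open>n - m - uppers m\<close>, so that \<open>g + t\<close> is the excess of the sum of the square.
\<close>

fun pick :: "int \<Rightarrow> int \<Rightarrow> nat list \<Rightarrow> nat list \<Rightarrow> nat list \<Rightarrow> letter list \<Rightarrow> nat list \<Rightarrow> nat option outcome" where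
  "pick s g R D S w [] = Ok None"
| "pick s g R D S w (t # ts) =
     (if t \<in> set R \<or> nat (s - int t) \<in> set D \<or> t \<in> set S then pick s g R D S w ts
      else if length w \<le> t then Read
      else if snd (w ! t) then pick s g R D S w ts
      else if g + int t < -1 then Bad
      else case attacked (g + int t) w of None \<Rightarrow> Read
           | Some b \<Rightarrow> if b then pick s g R D S w ts else Ok (Some t))"

definition taken :: "nat \<Rightarrow> nat \<Rightarrow> int \<Rightarrow> nat list \<Rightarrow> nat list \<Rightarrow> nat list \<Rightarrow> nat \<Rightarrow> bool" where
  "taken n m s R D S t \<longleftrightarrow> t \<in> set R \<or> nat (s - int t) \<in> set D \<or> t \<in> set S \<or>
     upper_row (m + t) \<or> upper_sum (n + m + t)"

lemma pick_Cons:
  assumes w: "w = tape_word m (length w)" and g: "int n = int (m + uppers m) + g"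
    and "pick s g R D S w (t # ts) = Ok r"
  shows "if taken n m s R D S t then pick s g R D S w ts = Ok r else r = Some t"
proof -
  have row: "snd (w ! t) \<longleftrightarrow> upper_row (m + t)" if "t < length w"
    by (subst w) (use that in \<open>simp add: tape_def\<close>)
  have sum: "b \<longleftrightarrow> upper_sum (n + m + t)" if "attacked (g + int t) w = Some b" "\<not> g + int t < -1" for b
    using attacked_iff[OF w that(1)] that(2) g by (simp add: algebra_simps)
  show ?thesis
    using assms(3) row by (auto simp: taken_def dest: sum split: if_splits option.splits)
qed

lemma pick_None:
  assumes "w = tape_word m (length w)" "int n = int (m + uppers m) + g" "pick s g R D S w ts = Ok None"
  shows "\<forall>t\<in>set ts. taken n m s R D S t"
  using assms(3)
proof (induction ts)
  case (Cons t ts)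
  then show ?case
    using pick_Cons[OF assms(1,2) Cons.prems] by (auto split: if_splits)
qed auto

lemma pick_Some:
  assumes "w = tape_word m (length w)" "int n = int (m + uppers m) + g" "pick s g R D S w [i..<k] = Ok (Some t)"
  shows "\<not> taken n m s R D S t \<and> i \<le> t \<and> t < k \<and> (\<forall>j. i \<le> j \<and> j < t \<longrightarrow> taken n m s R D S j)"
  using assms(3)
proof (induction "k - i" arbitrary: i)
  case (Suc d)
  then have i: "[i..<k] = i # [Suc i..<k]"
    by (simp add: upt_rec)
  show ?case
  proof (cases "taken n m s R D S i")
    case True
    then have "pick s g R D S w [Suc i..<k] = Ok (Some t)"
      using pick_Cons[OF assms(1,2) Suc.prems[unfolded i]] by simp
    moreover have "d = k - Suc i"
      using Suc.hyps(2) by simp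
    ultimately have "\<not> taken n m s R D S t \<and> Suc i \<le> t \<and> t < k \<and> (\<forall>j. Suc i \<le> j \<and> j < t \<longrightarrow> taken n m s R D S j)"
      using Suc.hyps(1) by blast
    then show ?thesis
      using True all_from_Suc[of i t "taken n m s R D S"] by auto
  next
    case False
    then show ?thesis
      using pick_Cons[OF assms(1,2) Suc.prems[unfolded i]] Suc.hyps(2) by auto
  qed
qed auto

fun first_open :: "nat list \<Rightarrow> letter list \<Rightarrow> nat \<Rightarrow> nat option" where
  "first_open R [] i = None"
| "first_open R ((a, b) # w) i = (if i \<in> set R \<or> b then first_open R w (Suc i) else Some i)"

lemma first_open_correct:
  assumes "first_open R w i = Some k" "w = tape_word (m + i) (length w)"
  shows "i \<le> k \<and> k < i + length w \<and> (\<forall>j. i \<le> j \<and> j < k \<longrightarrow> j \<in> set R \<or> upper_row (m + j))"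
  using assms
proof (induction R w i rule: first_open.induct)
  case (2 R a b w i)
  have b: "b = upper_row (m + i)" and w: "w = tape_word (m + Suc i) (length w)"
    using "2.prems"(2) unfolding tape_word_Cons by (auto simp: tape_def)
  show ?case
  proof (cases "i \<in> set R \<or> b")
    case True
    then have "Suc i \<le> k \<and> k < Suc i + length w \<and> (\<forall>j. Suc i \<le> j \<and> j < k \<longrightarrow> j \<in> set R \<or> upper_row (m + j))"
      using "2.IH"[OF True _ w] "2.prems"(1) by simp
    then show ?thesis
      using True b all_from_Suc[of i k "\<lambda>j. j \<in> set R \<or> upper_row (m + j)"] by auto
  next
    case False
    then show ?thesis
      using "2.prems"(1) by auto
  qed
qed auto

fun first_gap :: "nat list \<Rightarrow> nat list \<Rightarrow> nat \<Rightarrow> nat" where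
  "first_gap [] D i = i"
| "first_gap (x # xs) D i = (if i \<in> set D then first_gap xs D (Suc i) else i)"

lemma first_gap_correct: "i \<le> first_gap xs D i \<and> (\<forall>j. i \<le> j \<and> j < first_gap xs D i \<longrightarrow> j \<in> set D)"
proof (induction xs D i rule: first_gap.induct)
  case (2 x xs D i)
  then show ?case
    using all_from_Suc[of i "first_gap xs D (Suc i)" "\<lambda>j. j \<in> set D"] by auto
qed auto

definition shift :: "nat \<Rightarrow> nat list \<Rightarrow> nat list" where
  "shift k xs = map (\<lambda>x. x - k) (filter (\<lambda>x. k \<le> x) xs)"

lemma in_shift [simp]: "i \<in> set (shift k xs) \<longleftrightarrow> k + i \<in> set xs"
  by (force simp: shift_def)

fun insert_sorted :: "nat \<Rightarrow> nat list \<Rightarrow> nat list" where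
  "insert_sorted x [] = [x]"
| "insert_sorted x (y # ys) = (if x \<le> y then x # y # ys else y # insert_sorted x ys)"

lemma set_insert_sorted [simp]: "set (insert_sorted x xs) = insert x (set xs)"
  by (induction xs) auto

text \<open>
  The components are \<open>s\<close>, \<open>R\<close>, \<open>D\<close>, \<open>S\<close> as above, the letters of the tape that have been read from
  position \<open>m\<close> on, and two queues. Columns and rows of the tape are not decided at the same speed, so the
  columns or the rows that are ahead of the other kind wait in a queue until they form letters.
\<close>

datatype core = Core int "nat list" "nat list" "nat list" "letter list" "bool list" "bool list"

text \<open>
  One column of the board. If no candidate survives, the queen is an upper one and only \<open>s\<close> grows.
  Otherwise the first row and the first diagonal move past everything that is occupied, and the letters
  of the tape that the first row has passed are consumed. The result contains the letters that have become complete.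

  The inequalities are the numerical content of the whole construction: \<open>v\<close> will be seen to equal
  \<open>uppers n - m\<close>, hence \<open>t - v\<close> is the distance of a lower queen from row \<open>uppers n\<close>.
\<close>

definition advance :: "core \<Rightarrow> (letter list \<times> core) outcome" where
  "advance x = (case x of Core s R D S w as bs \<Rightarrow>
     let v = s - int (card (set D)); g = int (length as) - int (length bs) in
     (case pick s g R D S w [0..<nat (s + 1)] of
        Read \<Rightarrow> Read
      | Bad \<Rightarrow> Bad
      | Ok None \<Rightarrow>
          if v \<le> 2 \<and> - 5 \<le> v - 2 * int (card (set R)) then
            (let as' = as @ [True] in
             Ok (zip as' bs, Core (s + 1) R D (shift 1 S) w (drop (length bs) as') (drop (length as') bs)))
          else Bad
      | Ok (Some t) \<Rightarrow>
          if - 3 \<le> int t - v \<and> int t - v \<le> 4 then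
            (let R' = insert_sorted t R; D' = insert_sorted (nat (s - int t)) D; d = first_gap D' D' 0 in
             case first_open R' w 0 of
               None \<Rightarrow> Read
             | Some k \<Rightarrow>
                 (let as' = as @ [False]; bs' = bs @ row_word (take k w) in
                  Ok (zip as' bs', Core (s + 1 - int k - int d) (shift k R') (shift d D')
                        (shift (Suc k) (insert_sorted t S)) (drop k w)
                        (drop (length bs') as') (drop (length as') bs'))))
          else Bad))"

text \<open>
  The first bound keeps the piece of tape that is read clear of the piece that is written. The others
  bound the number of exceptional rows and the amount by which \<open>m\<close> may exceed \<open>uppers n\<close>, and so ensure
  that the upper queens never cease.
\<close>

definition tame :: "core \<Rightarrow> bool" where
  "tame x = (case x of Core s R D S w as bs \<Rightarrow>
     length w + length as \<le> 11 \<and> length R \<le> 5 \<and> length D \<le> 5 \<and> -5 \<le> s)"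

definition guarded_advance :: "core \<Rightarrow> (letter list \<times> core) outcome" where
  "guarded_advance x = (if tame x then advance x else Bad)"

section \<open>The machine follows the greedy rule\<close>

text \<open>
  The situation before column \<open>n\<close> is played: the rows below \<open>m\<close> and the diagonals below \<open>d\<close> are full,
  the lists contain exactly what is occupied beyond them, and the letters of the tape are complete up
  to position \<open>x\<close>. As columns before \<open>m\<close> decide the rows before \<open>m + uppers m\<close>, the two queues lead from
  \<open>x\<close> to \<open>n\<close> and to \<open>m + uppers m\<close>.
\<close>

fun describes :: "nat \<Rightarrow> nat \<Rightarrow> nat \<Rightarrow> nat \<Rightarrow> core \<Rightarrow> bool" where
  "describes n m d x (Core s R D S w as bs) \<longleftrightarrow>
     int n = int m + int d + s \<and>
     (\<forall>r<m. upper_row r \<or> lower_row n r) \<and> (\<forall>i. lower_row n (m + i) \<longleftrightarrow> i \<in> set R) \<and>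
     (\<forall>e<d. lower_diag n e) \<and> (\<forall>i. lower_diag n (d + i) \<longleftrightarrow> i \<in> set D) \<and>
     (\<forall>i. lower_sum n (n + m + i) \<longleftrightarrow> i \<in> set S) \<and>
     w = tape_word m (length w) \<and>
     x + length as = n \<and> as = map upper [x..<n] \<and>
     x + length bs = m + uppers m \<and> bs = map upper_row [x..<m + uppers m]"

lemma lower_row_Suc: "lower_row (Suc n) r \<longleftrightarrow> lower_row n r \<or> (\<not> upper n \<and> q n = r)"
  unfolding lower_row_def using less_Suc_eq by auto

lemma lower_diag_Suc: "lower_diag (Suc n) d \<longleftrightarrow> lower_diag n d \<or> (\<not> upper n \<and> q n + d = n)"
  unfolding lower_diag_def using less_Suc_eq by auto

lemma lower_sum_Suc: "lower_sum (Suc n) z \<longleftrightarrow> lower_sum n z \<or> (\<not> upper n \<and> q n + n = z)"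
  unfolding lower_sum_def using less_Suc_eq by auto

text \<open>
  Only the rows between \<open>m\<close> and \<open>m + s\<close> are candidates: below them the rows are full, above them the
  diagonals.
\<close>

lemma free_in_window:
  assumes "describes n m d x (Core s R D S w as bs)" "d > 0" "int t \<le> s"
  shows "m + t < n" "free n (m + t) \<longleftrightarrow> \<not> taken n m s R D S t"
proof -
  show lt: "m + t < n"
    using assms by simp
  have "int n = int m + int d + s"
    using assms(1) by simp
  then have "n - (m + t) = d + nat (s - int t)"
    using assms(3) by arith
  then show "free n (m + t) \<longleftrightarrow> \<not> taken n m s R D S t"
    using assms(1) unfolding free_iff[OF lt] taken_def by (auto simp: add.assoc[symmetric])
qed

lemma not_free_off_window:
  assumes "describes n m d x (Core s R D S w as bs)" "y < n" "\<not> (m \<le> y \<and> int y \<le> int m + s)"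
  shows "\<not> free n y"
proof (cases "y < m")
  case True
  then show ?thesis
    using assms by (auto simp: free_iff)
next
  case False
  then have "n - y < d"
    using assms by auto
  then show ?thesis
    using assms by (auto simp: free_iff)
qed

lemma zip_upt:
  assumes "as = map f [x..<x + length as]" "bs = map g [x..<x + length bs]"
  shows "zip as bs = map (\<lambda>y. (f y, g y)) [x..<x + length (zip as bs)]"
    and "drop (length bs) as = map f [x + length (zip as bs)..<x + length as]"
    and "drop (length as) bs = map g [x + length (zip as bs)..<x + length bs]"
proof -
  have [simp]: "as ! i = f (x + i)" if "i < length as" for i
    by (subst assms(1)) (use that in simp)
  have [simp]: "bs ! i = g (x + i)" if "i < length bs" for i
    by (subst assms(2)) (use that in simp)
  show "zip as bs = map (\<lambda>y. (f y, g y)) [x..<x + length (zip as bs)]"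
    by (rule nth_equalityI) auto
  show "drop (length bs) as = map f [x + length (zip as bs)..<x + length as]"
    by (rule nth_equalityI) (auto simp: min_def add.assoc)
  show "drop (length as) bs = map g [x + length (zip as bs)..<x + length bs]"
    by (rule nth_equalityI) (auto simp: min_def add.assoc)
qed

lemma describes_upper_step:
  assumes "describes n m d x (Core s R D S w as bs)" "upper n"
  defines "as' \<equiv> as @ [True]"
  shows "describes (Suc n) m d (x + length (zip as' bs))
           (Core (s + 1) R D (shift 1 S) w (drop (length bs) as') (drop (length as') bs))"
    and "zip as' bs = tape_word x (length (zip as' bs))"
proof -
  have as': "as' = map upper [x..<x + length as']" "x + length as' = Suc n"
    using assms by (auto simp: as'_def)
  have bs: "bs = map upper_row [x..<x + length bs]" "x + length bs = m + uppers m"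
    using assms by auto
  note z = zip_upt[OF as'(1) bs(1)]
  show "zip as' bs = tape_word x (length (zip as' bs))"
    using z(1) by (simp add: tape_def[abs_def])
  have "drop (length bs) as' = map upper [x + length (zip as' bs)..<Suc n]"
    using z(2) as'(2) by simp
  moreover have "drop (length as') bs = map upper_row [x + length (zip as' bs)..<m + uppers m]"
    using z(3) bs(2) by simp
  moreover have "x + length (zip as' bs) + length (drop (length bs) as') = Suc n"
    "x + length (zip as' bs) + length (drop (length as') bs) = m + uppers m"
    using as'(2) bs(2) by auto
  moreover have "\<forall>i. lower_sum n (Suc (n + m + i)) \<longleftrightarrow> Suc i \<in> set S"
  proof
    fix i
    have "lower_sum n (n + m + Suc i) \<longleftrightarrow> Suc i \<in> set S"
      using assms(1) unfolding describes.simps by blast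
    then show "lower_sum n (Suc (n + m + i)) \<longleftrightarrow> Suc i \<in> set S"
      by simp
  qed
  ultimately show "describes (Suc n) m d (x + length (zip as' bs))
           (Core (s + 1) R D (shift 1 S) w (drop (length bs) as') (drop (length as') bs))"
    using assms(1,2) by (auto simp: lower_row_Suc lower_diag_Suc lower_sum_Suc simp del: upt_Suc)
qed

lemma describes_lower_step:
  fixes s :: int
  assumes desc: "describes n m d x (Core s R D S w as bs)" and low: "\<not> upper n" "q n = m + t" "int t \<le> s"
  defines "R' \<equiv> insert_sorted t R" and "D' \<equiv> insert_sorted (nat (s - int t)) D"
  defines "d' \<equiv> first_gap D' D' 0"
  assumes k: "first_open R' w 0 = Some k"
  defines "as' \<equiv> as @ [False]" and "bs' \<equiv> bs @ row_word (take k w)"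
  shows "describes (Suc n) (m + k) (d + d') (x + length (zip as' bs'))
           (Core (s + 1 - int k - int d') (shift k R') (shift d' D') (shift (Suc k) (insert_sorted t S))
              (drop k w) (drop (length bs') as') (drop (length as') bs'))"
    and "zip as' bs' = tape_word x (length (zip as' bs'))"
    and "k \<le> length w"
proof -
  have w: "w = tape_word m (length w)"
    using desc by simp
  have open': "k < length w" "\<And>j. j < k \<Longrightarrow> j \<in> set R' \<or> upper_row (m + j)"
    using first_open_correct[OF k, of m] w by auto
  then show kw: "k \<le> length w"
    by simp
  have gap: "\<And>j. j < d' \<Longrightarrow> j \<in> set D'"
    using first_gap_correct[of 0 D' D'] by (auto simp: d'_def)
  have take_w: "take k w = tape_word m k"
    by (subst w) (use kw in \<open>simp add: take_map\<close>)
  have drop_w: "drop k w = tape_word (m + k) (length (drop k w))"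
    by (subst w) (use kw in \<open>simp add: drop_map\<close>)
  have bs: "bs = map upper_row [x..<m + uppers m]" "x + length bs = m + uppers m"
    using desc by auto
  have "m + uppers m \<le> m + k + uppers (m + k)"
    using uppers_mono[of m "m + k"] by simp
  then have bs'1: "bs' = map upper_row [x..<m + k + uppers (m + k)]"
    unfolding bs'_def take_w row_word_correct
    using bs upt_split[of x "m + uppers m" "m + k + uppers (m + k)"] by simp
  have "x \<le> m + k + uppers (m + k)"
    using bs(2) \<open>m + uppers m \<le> m + k + uppers (m + k)\<close> by linarith
  then have bs'2: "x + length bs' = m + k + uppers (m + k)"
    by (simp add: bs'1)
  have bs'3: "bs' = map upper_row [x..<x + length bs']"
    using bs'1 bs'2 by simp
  have as': "as' = map upper [x..<x + length as']" "x + length as' = Suc n"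
    using desc low by (auto simp: as'_def)
  note z = zip_upt[OF as'(1) bs'3]
  show "zip as' bs' = tape_word x (length (zip as' bs'))"
    using z(1) by (simp add: tape_def[abs_def])
  have dropas: "drop (length bs') as' = map upper [x + length (zip as' bs')..<Suc n]"
    using z(2) as'(2) by simp
  have dropbs: "drop (length as') bs' = map upper_row [x + length (zip as' bs')..<m + k + uppers (m + k)]"
    using z(3) bs'2 by simp
  have lens: "x + length (zip as' bs') + length (drop (length bs') as') = Suc n"
    "x + length (zip as' bs') + length (drop (length as') bs') = m + k + uppers (m + k)"
    using as'(2) bs'2 by auto
  have rows: "lower_row (Suc n) (m + i) \<longleftrightarrow> i \<in> set R'" for i
    using desc low by (auto simp: lower_row_Suc R'_def)
  have rows_below: "upper_row r \<or> lower_row (Suc n) r" if "r < m + k" for r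
  proof (cases "r < m")
    case True
    then show ?thesis
      using desc by (auto simp: lower_row_Suc)
  next
    case False
    then show ?thesis
      using open'(2)[of "r - m"] rows[of "r - m"] that by auto
  qed
  have nd: "n = m + t + (d + nat (s - int t))"
    using desc low(3) by auto
  have diags: "lower_diag (Suc n) (d + i) \<longleftrightarrow> i \<in> set D'" for i
    using desc low nd by (auto simp: lower_diag_Suc D'_def)
  have diags_below: "lower_diag (Suc n) e" if "e < d + d'" for e
  proof (cases "e < d")
    case True
    then show ?thesis
      using desc by (auto simp: lower_diag_Suc)
  next
    case False
    then show ?thesis
      using gap[of "e - d"] diags[of "e - d"] that by auto
  qed
  have sums: "lower_sum (Suc n) (n + m + i) \<longleftrightarrow> i \<in> set (insert_sorted t S)" for i
    using desc low by (auto simp: lower_sum_Suc)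
  have "lower_sum (Suc n) (Suc n + (m + k) + i) \<longleftrightarrow> i \<in> set (shift (Suc k) (insert_sorted t S))" for i
    using sums[of "Suc k + i"] by (simp add: add_ac)
  moreover have "int (Suc n) = int (m + k) + int (d + d') + (s + 1 - int k - int d')"
    using desc by simp
  moreover have "\<forall>i. lower_row (Suc n) (m + k + i) \<longleftrightarrow> i \<in> set (shift k R')"
    using rows by (simp add: add.assoc)
  moreover have "\<forall>i. lower_diag (Suc n) (d + d' + i) \<longleftrightarrow> i \<in> set (shift d' D')"
    using diags by (simp add: add.assoc)
  ultimately show "describes (Suc n) (m + k) (d + d') (x + length (zip as' bs'))
           (Core (s + 1 - int k - int d') (shift k R') (shift d' D') (shift (Suc k) (insert_sorted t S))
              (drop k w) (drop (length bs') as') (drop (length as') bs'))"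
    unfolding describes.simps using rows_below diags_below drop_w dropas dropbs lens by blast
qed

text \<open>
  Both numbers have a meaning on the board, see \<open>excess_eq\<close> and \<open>spare_eq\<close> below.
\<close>

fun excess :: "core \<Rightarrow> int" where "excess (Core s R D S w as bs) = s - int (card (set D))"
fun spare :: "core \<Rightarrow> int" where "spare (Core s R D S w as bs) = int (card (set R))"
fun window :: "core \<Rightarrow> letter list" where "window (Core s R D S w as bs) = w"

theorem advance_describes:
  assumes desc: "describes n m d x c" and "d > 0" and adv: "advance c = Ok (cs, c')"
  shows "\<exists>m' d' x'. describes (Suc n) m' d' x' c' \<and> m \<le> m' \<and> d \<le> d' \<and> x' = x + length cs \<and>
           cs = tape_word x (length cs) \<and> m' + length (window c') = m + length (window c)"
    and "upper n \<Longrightarrow> excess c \<le> 2 \<and> -5 \<le> excess c - 2 * spare c"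
    and "\<not> upper n \<Longrightarrow> -3 \<le> int (q n) - int m - excess c \<and> int (q n) - int m - excess c \<le> 4"
proof -
  obtain s R D S w as bs where c: "c = Core s R D S w as bs"
    by (cases c)
  have w: "w = tape_word m (length w)" and g: "int n = int (m + uppers m) + (int (length as) - int (length bs))"
    and n: "int n = int m + int d + s"
    using desc by (auto simp: c)
  obtain r where pick: "pick s (int (length as) - int (length bs)) R D S w [0..<nat (s + 1)] = Ok r"
    using adv by (cases "pick s (int (length as) - int (length bs)) R D S w [0..<nat (s + 1)]")
      (auto simp: c advance_def Let_def)
  have off: "\<not> free n y" if "y < n" "\<not> (m \<le> y \<and> int y \<le> int m + s)" for y
    using not_free_off_window[OF desc[unfolded c] that] .
  note inside = free_in_window[OF desc[unfolded c] \<open>d > 0\<close>]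
  have "(\<exists>m' d' x'. describes (Suc n) m' d' x' c' \<and> m \<le> m' \<and> d \<le> d' \<and> x' = x + length cs \<and>
           cs = tape_word x (length cs) \<and> m' + length (window c') = m + length (window c)) \<and>
        (upper n \<longrightarrow> excess c \<le> 2 \<and> -5 \<le> excess c - 2 * spare c) \<and>
        (\<not> upper n \<longrightarrow> -3 \<le> int (q n) - int m - excess c \<and> int (q n) - int m - excess c \<le> 4)"
  proof (cases r)
    case None
    have "\<not> free n y" if "y < n" for y
    proof (cases "m \<le> y \<and> int y \<le> int m + s")
      case True
      then have "y - m \<in> set [0..<nat (s + 1)]"
        by auto
      then have "taken n m s R D S (y - m)"
        using pick_None[OF w g pick[unfolded None]] by blast
      then show ?thesis
        using inside(2)[of "y - m"] True by auto
    qed (use off that in blast)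
    moreover have "lower_diag n 0"
      using desc \<open>d > 0\<close> by (simp add: c)
    then have "n > 0"
      by (auto simp: lower_diag_def)
    ultimately have up: "upper n"
      by (simp add: upper_iff)
    have guard: "excess c \<le> 2" "-5 \<le> excess c - 2 * spare c"
      and cs: "cs = zip (as @ [True]) bs"
      and c': "c' = Core (s + 1) R D (shift 1 S) w (drop (length bs) (as @ [True])) (drop (length (as @ [True])) bs)"
      using adv pick by (auto simp: c None advance_def Let_def split: if_splits)
    show ?thesis
      using describes_upper_step[OF desc[unfolded c] up, folded cs c'] up guard
      by (auto simp del: describes.simps simp: c c')
  next
    case (Some t)
    note p = pick_Some[OF w g pick[unfolded Some]]
    have ts: "int t \<le> s"
      using p by auto
    have before: "\<not> free n y" if "y < m + t" for y
    proof (cases "m \<le> y")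
      case True
      then have "taken n m s R D S (y - m)" "int (y - m) \<le> s"
        using p that ts by auto
      then show ?thesis
        using inside(2)[of "y - m"] True by auto
    next
      case False
      then show ?thesis
        using off[of y] that inside(1)[OF ts] by auto
    qed
    have "free n (m + t)"
      using inside(2)[OF ts] p by simp
    note low = lower_queen_eqI[OF inside(1)[OF ts] this before]
    obtain k where k: "first_open (insert_sorted t R) w 0 = Some k"
      and guard: "-3 \<le> int t - excess c" "int t - excess c \<le> 4"
      and cs: "cs = zip (as @ [False]) (bs @ row_word (take k w))"
      and c': "c' = (let R' = insert_sorted t R; D' = insert_sorted (nat (s - int t)) D; d' = first_gap D' D' 0;
                  as' = as @ [False]; bs' = bs @ row_word (take k w)
                in Core (s + 1 - int k - int d') (shift k R') (shift d' D') (shift (Suc k) (insert_sorted t S))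
                     (drop k w) (drop (length bs') as') (drop (length as') bs'))"
      using adv pick by (auto simp: c Some advance_def Let_def split: if_splits option.splits)
    note step = describes_lower_step[OF desc[unfolded c] low ts k]
    have "window c' = drop k w"
      by (simp add: c' Let_def)
    then have "m + k + length (window c') = m + length (window c)"
      using step(3) by (simp add: c)
    moreover have "describes (Suc n) (m + k)
        (d + first_gap (insert_sorted (nat (s - int t)) D) (insert_sorted (nat (s - int t)) D) 0)
        (x + length cs) c'"
      using step(1) unfolding c' cs Let_def .
    moreover have "cs = tape_word x (length cs)"
      using step(2) unfolding cs .
    ultimately have "\<exists>m' d' x'. describes (Suc n) m' d' x' c' \<and> m \<le> m' \<and> d \<le> d' \<and> x' = x + length cs \<and>
           cs = tape_word x (length cs) \<and> m' + length (window c') = m + length (window c)"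
      using le_add1 by blast
    then show ?thesis
      using low guard by simp
  qed
  then show "\<exists>m' d' x'. describes (Suc n) m' d' x' c' \<and> m \<le> m' \<and> d \<le> d' \<and> x' = x + length cs \<and>
           cs = tape_word x (length cs) \<and> m' + length (window c') = m + length (window c)"
    and "upper n \<Longrightarrow> excess c \<le> 2 \<and> -5 \<le> excess c - 2 * spare c"
    and "\<not> upper n \<Longrightarrow> -3 \<le> int (q n) - int m - excess c \<and> int (q n) - int m - excess c \<le> 4"
    by blast+
qed

section \<open>Counting the lower queens\<close>

text \<open>
  The lower queens before column \<open>n\<close> are counted twice, by diagonals and by rows. This turns the shape
  of the occupied region into two equations for \<open>uppers n\<close>.
\<close>

lemma card_lower: "card {c. c < n \<and> \<not> upper c} = n - uppers n"
proof -
  have "{c. c < n \<and> \<not> upper c} = {..<n} - {a. a < n \<and> upper a}"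
    by auto
  moreover have "card ({..<n} - {a. a < n \<and> upper a}) = card {..<n} - card {a. a < n \<and> upper a}"
    by (rule card_Diff_subset) auto
  ultimately show ?thesis
    by (simp add: uppers_def)
qed

lemma card_lower_diags: "card {e. lower_diag n e} = n - uppers n"
proof -
  have "{e. lower_diag n e} = (\<lambda>c. c - q c) ` {c. c < n \<and> \<not> upper c}"
  proof (intro set_eqI iffI)
    fix e assume "e \<in> {e. lower_diag n e}"
    then obtain c where "c < n" "\<not> upper c" "q c + e = c"
      by (auto simp: lower_diag_def)
    then show "e \<in> (\<lambda>c. c - q c) ` {c. c < n \<and> \<not> upper c}"
      by (intro image_eqI[of _ _ c]) auto
  next
    fix e assume "e \<in> (\<lambda>c. c - q c) ` {c. c < n \<and> \<not> upper c}"
    then obtain c where "c < n" "\<not> upper c" "e = c - q c"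
      by auto
    then show "e \<in> {e. lower_diag n e}"
      using lower_queen_le[of c] by (auto simp: lower_diag_def)
  qed
  moreover have "inj_on (\<lambda>c. c - q c) {c. c < n \<and> \<not> upper c}"
  proof (rule inj_onI)
    fix b c assume bc: "b \<in> {c. c < n \<and> \<not> upper c}" "c \<in> {c. c < n \<and> \<not> upper c}" "b - q b = c - q c"
    then have "int (q b) - int b = int (q c) - int c"
      using lower_queen_le[of b] lower_queen_le[of c] by auto
    then show "b = c"
      using queens_do_not_attack(2) by (metis nat_neq_iff)
  qed
  ultimately show ?thesis
    by (simp add: card_image card_lower)
qed

lemma card_lower_rows: "card {r. lower_row n r} = n - uppers n"
proof -
  have "{r. lower_row n r} = q ` {c. c < n \<and> \<not> upper c}"
    by (auto simp: lower_row_def)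
  moreover have "inj_on q {c. c < n \<and> \<not> upper c}"
    by (meson inj_onI inj_queen)
  ultimately show ?thesis
    by (simp add: card_image card_lower)
qed

lemma card_below_and_shifted:
  fixes k :: nat
  assumes "finite B" "finite A" "B \<subseteq> {..<k}"
  shows "card (B \<union> (+) k ` A) = card B + card A"
proof -
  have "B \<inter> (+) k ` A = {}"
    using assms(3) by auto
  then show ?thesis
    using assms by (subst card_Un_disjoint) (auto simp: card_image)
qed

lemma excess_eq:
  assumes "describes n m d x c"
  shows "int (uppers n) = int m + excess c"
proof -
  obtain s R D S w as bs where c: "c = Core s R D S w as bs"
    by (cases c)
  have n: "int n = int m + int d + s" and below: "\<forall>e<d. lower_diag n e"
    and above: "\<forall>i. lower_diag n (d + i) \<longleftrightarrow> i \<in> set D"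
    using assms unfolding c describes.simps by blast+
  have "{e. lower_diag n e} = {..<d} \<union> (+) d ` set D"
  proof (rule set_eqI)
    fix e
    show "e \<in> {e. lower_diag n e} \<longleftrightarrow> e \<in> {..<d} \<union> (+) d ` set D"
    proof (cases "e < d")
      case True
      then show ?thesis
        using below by simp
    next
      case False
      then have "e = d + (e - d)"
        by simp
      then show ?thesis
        using above[rule_format, of "e - d"] False by (auto simp: image_iff intro!: bexI[of _ "e - d"])
    qed
  qed
  then have "n - uppers n = d + card (set D)"
    using card_lower_diags[of n] card_below_and_shifted[of "{..<d}" "set D" d] by simp
  moreover have "uppers n \<le> n"
    by (rule uppers_le)
  ultimately show ?thesis
    using n by (simp add: c)
qed

lemma spare_eq:
  assumes "describes n m d x c"
  shows "int n - int (uppers n) = int m - int (card {r. r < m \<and> upper_row r}) + spare c"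
proof -
  obtain s R D S w as bs where c: "c = Core s R D S w as bs"
    by (cases c)
  have below: "\<forall>r<m. upper_row r \<or> lower_row n r"
    and above: "\<forall>i. lower_row n (m + i) \<longleftrightarrow> i \<in> set R"
    using assms unfolding c describes.simps by blast+
  have excl: "\<not> upper_row r" if "lower_row n r" for r
    using that inj_queen by (auto simp: lower_row_def upper_row_def)
  have "{r. lower_row n r} = ({..<m} - {r. r < m \<and> upper_row r}) \<union> (+) m ` set R"
  proof (rule set_eqI)
    fix r
    show "r \<in> {r. lower_row n r} \<longleftrightarrow> r \<in> ({..<m} - {r. r < m \<and> upper_row r}) \<union> (+) m ` set R"
    proof (cases "r < m")
      case True
      then show ?thesis
        using below excl by auto
    next
      case False
      then have "r = m + (r - m)"
        by simp
      then show ?thesis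
        using above[rule_format, of "r - m"] False by (auto simp: image_iff intro!: bexI[of _ "r - m"])
    qed
  qed
  then have "n - uppers n = card ({..<m} - {r. r < m \<and> upper_row r}) + card (set R)"
    using card_lower_rows[of n]
      card_below_and_shifted[of "{..<m} - {r. r < m \<and> upper_row r}" "set R" m] by auto
  moreover have "card ({..<m} - {r. r < m \<and> upper_row r}) = m - card {r. r < m \<and> upper_row r}"
    by (subst card_Diff_subset) auto
  moreover have "card {r. r < m \<and> upper_row r} \<le> m"
    using card_mono[of "{..<m}" "{r. r < m \<and> upper_row r}"] by auto
  moreover have "uppers n \<le> n"
    by (rule uppers_le)
  ultimately show ?thesis
    by (simp add: c)
qed

lemma card_upper_rows:
  assumes "upper a" "q a < m" "\<And>b. upper b \<Longrightarrow> a < b \<Longrightarrow> m \<le> q b"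
  shows "card {r. r < m \<and> upper_row r} = uppers a + 1"
proof -
  have "q b < m" if "upper b" "b \<le> a" for b
    using that assms(1,2) uppers_mono[of b a] by (simp add: upper_queen)
  then have "{r. r < m \<and> upper_row r} = q ` {b. b < Suc a \<and> upper b}"
  proof (intro set_eqI iffI)
    fix r assume "r \<in> {r. r < m \<and> upper_row r}"
    then obtain b where b: "upper b" "q b = r" "r < m"
      by (auto simp: upper_row_def)
    then have "\<not> a < b"
      using assms(3)[of b] by auto
    then show "r \<in> q ` {b. b < Suc a \<and> upper b}"
      using b by (intro image_eqI[of _ _ b]) auto
  qed (auto simp: upper_row_def)
  moreover have "inj_on q {b. b < Suc a \<and> upper b}"
    by (meson inj_onI inj_queen)
  ultimately have "card {r. r < m \<and> upper_row r} = uppers (Suc a)"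
    unfolding uppers_def by (simp add: card_image)
  then show ?thesis
    using assms(1) by simp
qed

section \<open>Contraction towards the golden ratio\<close>

lemma golden: "golden_ratio * golden_ratio = golden_ratio + 1" "1618 / 1000 < golden_ratio" "golden_ratio < 16181 / 10000"
  "1 / golden_ratio = golden_ratio - 1"
proof -
  have s: "sqrt 5 * sqrt 5 = 5"
    by simp
  then show sq: "golden_ratio * golden_ratio = golden_ratio + 1"
    unfolding golden_ratio_def by (simp add: field_simps)
  have "2236 / 1000 < sqrt 5" "sqrt 5 < 22362 / 10000"
    by (rule real_less_rsqrt; simp add: power2_eq_square) (rule real_less_lsqrt; simp add: power2_eq_square)
  then show "1618 / 1000 < golden_ratio" "golden_ratio < 16181 / 10000"
    unfolding golden_ratio_def by simp_all
  then have "golden_ratio \<noteq> 0" "golden_ratio * (golden_ratio - 1) = 1"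
    using sq by (simp_all add: algebra_simps)
  then show "1 / golden_ratio = golden_ratio - 1"
    by (metis nonzero_mult_div_cancel_left)
qed

text \<open>
  Here \<open>i\<close> is the rank of the upper queen in column \<open>n\<close>, and \<open>j\<close> that of the last upper queen in a row
  below \<open>m\<close>, whose column is \<open>a\<close>. Eliminating \<open>m\<close> from the two counts expresses the deviation
  \<open>i - n / \<phi>\<close> by the deviation \<open>j - a / \<phi>\<close> with the factor \<open>1 / \<phi>\<^sup>2\<close>; recall that \<open>\<phi>\<^sup>2 = \<phi> + 1\<close> and
  \<open>1 / \<phi> = \<phi> - 1\<close>.
\<close>

lemma contraction_upper:
  fixes \<phi> n i j m v r a :: real
  assumes \<phi>: "\<phi> * \<phi> = \<phi> + 1" "\<phi> > 1"
    and "i = m + v + 1" "n - (i - 1) = m - j + r" "a + j \<le> m - 1"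
  shows "(\<phi> + 1) * (i - n * (\<phi> - 1)) \<le> 2 + v - \<phi> * r + (j - a * (\<phi> - 1))"
proof -
  have n: "n = 2 * m + v - j + r"
    using assms(3,4) by simp
  have "(\<phi> + 1) * (i - n * (\<phi> - 1)) = (\<phi> + 1) * i - n * (\<phi> * \<phi> - 1)"
    by (simp add: algebra_simps)
  also have "\<dots> = (\<phi> + 1) * i - n * \<phi>"
    unfolding \<phi>(1) by simp
  also have "\<dots> = m * (1 - \<phi>) + v + \<phi> + 1 + \<phi> * j - \<phi> * r"
    unfolding n assms(3) by (simp add: algebra_simps)
  finally have eq: "(\<phi> + 1) * (i - n * (\<phi> - 1)) = \<dots>" .
  have "a * (\<phi> - 1) \<le> (m - 1 - j) * (\<phi> - 1)"
    using assms(5) \<phi>(2) by (intro mult_right_mono) auto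
  then show ?thesis
    unfolding eq by (simp add: algebra_simps)
qed

text \<open>
  The same elimination with the first upper queen, of rank \<open>j + 1\<close> and in column \<open>a\<close>, that is not in a
  row below \<open>m\<close>.
\<close>

lemma contraction_lower:
  fixes \<phi> n i j m v r a :: real
  assumes \<phi>: "\<phi> * \<phi> = \<phi> + 1" "\<phi> > 1"
    and "i = m + v + 1" "n - (i - 1) = m - j + r" "m \<le> a + j + 1"
  shows "1 + v - \<phi> * r + (j + 1 - a * (\<phi> - 1)) \<le> (\<phi> + 1) * (i - n * (\<phi> - 1))"
proof -
  have n: "n = 2 * m + v - j + r"
    using assms(3,4) by simp
  have "(\<phi> + 1) * (i - n * (\<phi> - 1)) = (\<phi> + 1) * i - n * (\<phi> * \<phi> - 1)"
    by (simp add: algebra_simps)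
  also have "\<dots> = (\<phi> + 1) * i - n * \<phi>"
    unfolding \<phi>(1) by simp
  also have "\<dots> = m * (1 - \<phi>) + v + \<phi> + 1 + \<phi> * j - \<phi> * r"
    unfolding n assms(3) by (simp add: algebra_simps)
  finally have eq: "(\<phi> + 1) * (i - n * (\<phi> - 1)) = \<dots>" .
  have "(m - j - 1) * (\<phi> - 1) \<le> a * (\<phi> - 1)"
    using assms(5) \<phi>(2) by (intro mult_right_mono) auto
  then show ?thesis
    unfolding eq by (simp add: algebra_simps)
qed

text \<open>
  The bounds \<open>20\<close> and \<open>13\<close> are the values of \<open>m\<close> and \<open>d\<close> in column \<open>31\<close>, where the description will start.
\<close>

definition controlled :: "nat \<Rightarrow> bool" where
  "controlled n \<longleftrightarrow> (\<exists>m d x c cs c'. describes n m d x c \<and> 20 \<le> m \<and> 13 \<le> d \<and> tame c \<and> advance c = Ok (cs, c'))"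

lemma controlledE:
  assumes "controlled n"
  obtains m :: nat and v r :: int where "20 \<le> m" "m < n" "int (uppers n) = int m + v"
    "int n - int (uppers n) = int m - int (card {y. y < m \<and> upper_row y}) + r" "0 \<le> r" "r \<le> 5" "-10 \<le> v"
    "upper n \<Longrightarrow> v \<le> 2 \<and> -5 \<le> v - 2 * r"
    "\<not> upper n \<Longrightarrow> -3 \<le> int (q n) - int (uppers n) \<and> int (q n) - int (uppers n) \<le> 4"
proof -
  obtain m d x c cs c' where c: "describes n m d x c" "20 \<le> m" "13 \<le> d" "tame c" "advance c = Ok (cs, c')"
    using assms unfolding controlled_def by blast
  obtain s R D S w as bs where core: "c = Core s R D S w as bs"
    by (cases c)
  have tame: "length R \<le> 5" "length D \<le> 5" "-5 \<le> s"
    using c(4) by (simp_all add: core tame_def)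
  have "int n = int m + int d + s"
    using c(1) unfolding core describes.simps by blast
  then have "m < n"
    using c(3) tame by linarith
  moreover have "0 \<le> spare c" "spare c \<le> 5"
    using card_length[of R] tame by (simp_all add: core)
  moreover have "-10 \<le> excess c"
    using card_length[of D] tame by (simp add: core)
  moreover have "upper n \<Longrightarrow> excess c \<le> 2 \<and> -5 \<le> excess c - 2 * spare c"
    "\<not> upper n \<Longrightarrow> -3 \<le> int (q n) - int (uppers n) \<and> int (q n) - int (uppers n) \<le> 4"
    using advance_describes(2,3)[OF c(1) _ c(5)] c(3) excess_eq[OF c(1)] by auto
  ultimately show thesis
    using that c(2) excess_eq[OF c(1)] spare_eq[OF c(1)] by blast
qed

lemma controlled_lower:
  assumes "controlled n" "\<not> upper n"
  shows "-3 \<le> int (q n) - int (uppers n) \<and> int (q n) - int (uppers n) \<le> 4"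
  using assms(1)
proof (rule controlledE)
qed (use assms(2) in blast)

lemma controlled_upper:
  assumes "controlled n" "upper n"
  shows "\<exists>m v r. 20 \<le> m \<and> m < n \<and> int (uppers n) = int m + v \<and>
     int n - int (uppers n) = int m - int (card {y. y < m \<and> upper_row y}) + r \<and> 0 \<le> r \<and> v \<le> 2 \<and> -5 \<le> v - 2 * r"
  using assms(1)
proof (rule controlledE)
qed (use assms(2) in blast)

lemma uppers_eq:
  assumes "a \<le> b" "\<And>c. a \<le> c \<Longrightarrow> c < b \<Longrightarrow> \<not> upper c"
  shows "uppers b = uppers a"
proof -
  have "{c. c < b \<and> upper c} = {c. c < a \<and> upper c}"
  proof (intro Collect_cong)
    show "c < b \<and> upper c \<longleftrightarrow> c < a \<and> upper c" for c
    proof (cases "c < a")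
      case True
      then show ?thesis
        using assms(1) by simp
    next
      case False
      then show ?thesis
        using assms(2)[of c] by auto
    qed
  qed
  then show ?thesis
    unfolding uppers_def by (rule arg_cong)
qed

lemma last_upper:
  fixes P :: "nat \<Rightarrow> bool"
  assumes "upper b" "P b" "\<And>a. P a \<Longrightarrow> a < n"
  obtains a where "upper a" "P a" "b \<le> a" "\<And>c. upper c \<Longrightarrow> P c \<Longrightarrow> c \<le> a"
proof -
  let ?A = "{a. upper a \<and> P a}"
  have fin: "finite ?A"
    by (rule finite_subset[of _ "{..<n}"]) (use assms(3) in auto)
  have "Max ?A \<in> ?A"
    using assms(1,2) by (intro Max_in[OF fin]) auto
  then have max: "upper (Max ?A)" "P (Max ?A)"
    by simp_all
  have above: "c \<le> Max ?A" if "upper c" "P c" for c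
    using that by (intro Max_ge[OF fin]) simp
  show thesis
    by (rule that[OF max above[OF assms(1,2)] above])
qed

lemma next_upper:
  assumes "upper n" "a < n"
  obtains b where "upper b" "a < b" "b \<le> n" "\<And>c. upper c \<Longrightarrow> a < c \<Longrightarrow> b \<le> c"
proof
  let ?P = "\<lambda>b. upper b \<and> a < b"
  have "?P (Least ?P)"
    using assms by (intro LeastI[of ?P n]) simp
  then show "upper (Least ?P)" "a < Least ?P"
    by simp_all
  show "Least ?P \<le> n"
    using assms by (intro Least_le) simp
  show "Least ?P \<le> c" if "upper c" "a < c" for c
    using that by (intro Least_le) simp
qed

text \<open>
  This is \<open>i - a / \<phi>\<close> for an upper queen of rank \<open>i\<close> in column \<open>a\<close>. As its row is \<open>a + i\<close>, it equals
  the deviation \<open>q a - a * \<phi>\<close> of the theorem.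
\<close>

definition offset :: "nat \<Rightarrow> real" where
  "offset a = real (uppers a + 1) - real a * (golden_ratio - 1)"

lemma upper_offset: "upper a \<Longrightarrow> real (q a) - real a * golden_ratio = offset a"
  by (simp add: upper_queen offset_def algebra_simps)

text \<open>
  The columns before \<open>31\<close> start the inductions. Column \<open>8\<close> ensures that there is an upper queen in a
  row below \<open>m\<close>, and in a column that is not too small.
\<close>

context
  assumes controlled: "\<And>n. n \<ge> 31 \<Longrightarrow> controlled n"
    and upper_8: "upper 8" "q 8 < 20"
    and small: "\<And>n. upper n \<Longrightarrow> n < 31 \<Longrightarrow> \<bar>offset n\<bar> < 5 * (golden_ratio - 1)"
begin

text \<open>
  By the contraction, a bound \<open>E\<close> for smaller columns gives the bounds \<open>(2 + v - \<phi> * r + E) / \<phi>\<^sup>2\<close> from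
  above and \<open>(1 + v - \<phi> * r - E) / \<phi>\<^sup>2\<close> from below. With \<open>v \<le> 2\<close> and \<open>v - 2 * r \<ge> -5\<close> the value
  \<open>E = 5 / \<phi> = 5 * (\<phi> - 1)\<close> reproduces itself.
\<close>

lemma offset_bound: "upper n \<Longrightarrow> \<bar>offset n\<bar> < 5 * (golden_ratio - 1)"
proof (induction n rule: less_induct)
  case (less n)
  show ?case
  proof (cases "n < 31")
    case True
    then show ?thesis
      using small less.prems by blast
  next
    case False
    then have n: "n \<ge> 31"
      by simp
    obtain m :: nat and v r :: int where m: "20 \<le> m" "m < n" and v: "int (uppers n) = int m + v"
      and r: "int n - int (uppers n) = int m - int (card {y. y < m \<and> upper_row y}) + r" "0 \<le> r"
      and vr: "v \<le> 2" "-5 \<le> v - 2 * r"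
      using controlled_upper[OF controlled[OF n] less.prems] by blast
    obtain a where a: "upper a" "q a < m" "8 \<le> a" and last: "\<And>c. upper c \<Longrightarrow> q c < m \<Longrightarrow> c \<le> a"
    proof (rule last_upper[of 8 "\<lambda>a. a < m \<and> q a < m" m])
      show "8 < m \<and> q 8 < m"
        using upper_8 m by simp
      fix a assume "upper a" "a < m \<and> q a < m" "8 \<le> a" "\<And>c. upper c \<Longrightarrow> c < m \<and> q c < m \<Longrightarrow> c \<le> a"
      moreover from this have "c \<le> a" if "upper c" "q c < m" for c
        using that by (simp add: upper_def)
      ultimately show thesis
        using that[of a] by blast
    qed (use upper_8 in auto)
    have "a < n"
      using a(1,2) m(2) by (simp add: upper_def)
    obtain b where b: "upper b" "a < b" "b \<le> n" and none: "\<And>c. upper c \<Longrightarrow> a < c \<Longrightarrow> b \<le> c"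
      using next_upper[OF less.prems \<open>a < n\<close>] by blast
    have j: "card {y. y < m \<and> upper_row y} = uppers a + 1"
    proof (rule card_upper_rows[OF a(1,2)])
      show "m \<le> q c" if "upper c" "a < c" for c
        using last[of c] that by linarith
    qed
    have "\<not> upper c" if "Suc a \<le> c" "c < b" for c
      using none[of c] that by auto
    then have ub: "uppers b = uppers a + 1"
      using uppers_eq[of "Suc a" b] b(2) a(1) by auto
    have qa: "a + (uppers a + 1) < m"
      using a(2) upper_queen[OF a(1)] by simp
    have "m \<le> q b"
      using last[OF b(1)] b(2) by linarith
    then have qb: "m \<le> b + (uppers a + 1) + 1"
      using upper_queen[OF b(1)] ub by simp
    (* If b = n, then uppers a + 1 = uppers n = m + v, and a + uppers a + 1 < m yields a < - v \<le> 5. *)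
    have "b \<noteq> n"
    proof
      assume "b = n"
      then have "int (uppers a) + 1 = int m + v"
        using v ub by simp
      then have "int a < - v"
        using qa by linarith
      then show False
        using a(3) vr r(2) by linarith
    qed
    then have IH: "offset a < 5 * (golden_ratio - 1)" "- 5 * (golden_ratio - 1) < offset b"
      using less.IH[OF \<open>a < n\<close> a(1)] less.IH[of b] b by auto
    have i: "real (uppers n + 1) = real m + of_int v + 1"
      using arg_cong[OF v, of real_of_int] by simp
    have "real n - real (uppers n) = real m - real (uppers a + 1) + of_int r"
      using arg_cong[OF r(1), of real_of_int] j by simp
    then have nj: "real n - (real (uppers n + 1) - 1) = real m - real (uppers a + 1) + of_int r"
      by simp
    have \<phi>: "golden_ratio > 1" "golden_ratio < 2"
      using golden by linarith+
    have "(golden_ratio + 1) * offset n \<le> 2 + of_int v - golden_ratio * of_int r + offset a"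
      unfolding offset_def using qa
      by (intro contraction_upper[OF golden(1) \<phi>(1) i nj]) linarith
    also have "\<dots> < 4 + 5 * (golden_ratio - 1)"
    proof -
      have "0 \<le> golden_ratio * of_int r"
        using \<phi> r(2) by simp
      then show ?thesis
        using IH(1) vr(1) by linarith
    qed
    also have "\<dots> < (golden_ratio + 1) * (5 * (golden_ratio - 1))"
      using golden by (simp add: algebra_simps)
    finally have up: "offset n < 5 * (golden_ratio - 1)"
      using \<phi> by simp
    have "offset b = real (uppers a + 1) + 1 - real b * (golden_ratio - 1)"
      by (simp add: offset_def ub)
    then have "1 + of_int v - golden_ratio * of_int r + offset b \<le> (golden_ratio + 1) * offset n"
      using contraction_lower[OF golden(1) \<phi>(1) i nj, of "real b"] qb unfolding offset_def by linarith
    moreover have "(golden_ratio + 1) * (- 5 * (golden_ratio - 1)) < 1 + of_int v - golden_ratio * of_int r + offset b"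
    proof -
      have "golden_ratio * of_int r \<le> 2 * of_int r"
        using \<phi> r(2) by (intro mult_right_mono) auto
      moreover have "- 5 \<le> real_of_int v - 2 * of_int r"
        using vr(2) by linarith
      ultimately have "- 5 * golden_ratio < 1 + of_int v - golden_ratio * of_int r + offset b"
        using IH(2) by (simp add: algebra_simps)
      moreover have "(golden_ratio + 1) * (- 5 * (golden_ratio - 1)) = - 5 * golden_ratio"
        using golden(1) by (simp add: algebra_simps)
      ultimately show ?thesis
        by simp
    qed
    ultimately have "(golden_ratio + 1) * (- 5 * (golden_ratio - 1)) < (golden_ratio + 1) * offset n"
      by linarith
    then have "- 5 * (golden_ratio - 1) < offset n"
      using \<phi> mult_less_cancel_left_pos[of "golden_ratio + 1"] by simp
    then show ?thesis
      using up by (simp add: abs_less_iff)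
  qed
qed

text \<open>
  If there were no further upper queen, then \<open>uppers\<close> would be constant from some column on, so \<open>m\<close> and
  with it the number of lower queens would be bounded.
\<close>

lemma ex_later_upper: "\<exists>b>n. upper b"
proof (rule ccontr)
  assume none: "\<not> (\<exists>b>n. upper b)"
  define N where "N = Suc n + 2 * uppers (Suc n) + 31"
  have "uppers N = uppers (Suc n)"
    using none by (intro uppers_eq) (auto simp: N_def)
  moreover have "controlled N"
    by (intro controlled) (simp add: N_def)
  then obtain m :: nat and v r :: int where "int (uppers N) = int m + v" "-10 \<le> v" "r \<le> 5"
    "int N - int (uppers N) = int m - int (card {y. y < m \<and> upper_row y}) + r"
    by (rule controlledE)
  ultimately show False
    unfolding N_def by linarith
qed

text \<open>
  The queen is within \<open>-3\<close> and \<open>4\<close> of row \<open>uppers n\<close>, and \<open>uppers n\<close> is compared with \<open>n / \<phi>\<close> by means of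
  the upper queens just before and just after column \<open>n\<close>.
\<close>

lemma lower_bound:
  assumes "n \<ge> 31" "\<not> upper n"
  shows "\<bar>real (q n) - real n * (golden_ratio - 1)\<bar> < 4 + 5 * (golden_ratio - 1)"
proof -
  have w: "-3 \<le> int (q n) - int (uppers n)" "int (q n) - int (uppers n) \<le> 4"
    using controlled_lower[OF controlled[OF assms(1)] assms(2)] by blast+
  obtain a where a: "upper a" "a < n" "\<And>c. upper c \<Longrightarrow> c < n \<Longrightarrow> c \<le> a"
    using last_upper[of 8 "\<lambda>a. a < n" n] upper_8 assms(1) by auto
  obtain b where b: "upper b" "n < b" and none: "\<And>c. upper c \<Longrightarrow> n < c \<Longrightarrow> b \<le> c"
    using ex_later_upper[of n] next_upper by blast
  have "uppers n = uppers (Suc a)"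
  proof (rule uppers_eq)
    show "\<not> upper c" if "Suc a \<le> c" "c < n" for c
      using a(3)[of c] that by auto
  qed (use a(2) in simp)
  then have ua: "uppers n = uppers a + 1"
    using a(1) by simp
  have "uppers b = uppers n"
  proof (rule uppers_eq)
    show "\<not> upper c" if "n \<le> c" "c < b" for c
      using none[of c] assms(2) that by (cases "c = n") auto
  qed (use b(2) in simp)
  then have ob: "offset b = real (uppers n) + 1 - real b * (golden_ratio - 1)"
    by (simp add: offset_def)
  have oa: "offset a = real (uppers n) - real a * (golden_ratio - 1)"
    by (simp add: offset_def ua)
  have \<phi>: "golden_ratio > 1"
    using golden by linarith
  have "real a * (golden_ratio - 1) < real n * (golden_ratio - 1)"
    "real n * (golden_ratio - 1) < real b * (golden_ratio - 1)"
    using a(2) b(2) \<phi> by simp_all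
  moreover have "-3 \<le> real (q n) - real (uppers n)" "real (q n) - real (uppers n) \<le> 4"
    using w by linarith+
  ultimately show ?thesis
    using offset_bound[OF a(1)] offset_bound[OF b(1)] oa ob unfolding abs_less_iff by linarith
qed

end

section \<open>Searching the reachable states\<close>

text \<open>
  The search below is carried out by rewriting. For this reason a table or a set of states that is
  large is always a plain argument of a function defined by pattern matching, and never stands inside a
  case distinction, where each step would traverse it again. Positions in a tree are given by binary
  numerals, least significant digit first.
\<close>

datatype 'a tree = Leaf | Node 'a "'a tree" "'a tree"

fun node_at :: "'a tree \<Rightarrow> num \<Rightarrow> 'a option" where
  "node_at Leaf k = None"
| "node_at (Node a l r) num.One = Some a"
| "node_at (Node a l r) (num.Bit0 k) = node_at l k"
| "node_at (Node a l r) (num.Bit1 k) = node_at r k"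

fun insert_at :: "num \<Rightarrow> 'a \<Rightarrow> 'a list tree \<Rightarrow> 'a list tree" where
  "insert_at num.One x Leaf = Node [x] Leaf Leaf"
| "insert_at (num.Bit0 k) x Leaf = Node [] (insert_at k x Leaf) Leaf"
| "insert_at (num.Bit1 k) x Leaf = Node [] Leaf (insert_at k x Leaf)"
| "insert_at num.One x (Node a l r) = Node (x # a) l r"
| "insert_at (num.Bit0 k) x (Node a l r) = Node a (insert_at k x l) r"
| "insert_at (num.Bit1 k) x (Node a l r) = Node a l (insert_at k x r)"

fun unzip :: "'a list \<Rightarrow> 'a list \<times> 'a list" where
  "unzip (x # y # zs) = (let (xs, ys) = unzip zs in (x # xs, y # ys))"
| "unzip [x] = ([x], [])"
| "unzip [] = ([], [])"

lemma length_unzip: "length (fst (unzip xs)) \<le> length xs" "length (snd (unzip xs)) \<le> length xs"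
  by (induction xs rule: unzip.induct) (auto split: prod.splits)

function tree_of :: "'a list \<Rightarrow> 'a tree" where
  "tree_of [] = Leaf"
| "tree_of (x # xs) = (let p = unzip xs in Node x (tree_of (fst p)) (tree_of (snd p)))"
  by pat_completeness auto
termination
  by (relation "measure length") (auto simp: le_imp_less_Suc length_unzip)

text \<open>
  Automaton states are numbered from \<open>1\<close>; the entry \<open>0\<close> of a table means that there is no transition.
\<close>

definition label :: "int \<Rightarrow> num option" where
  "label i = (if i \<le> 0 then None else Some (num_of_nat (nat i)))"

lemma label_code [code]: "label 0 = None" "label (Int.Pos k) = Some k" "label (Int.Neg k) = None"
  by (simp_all add: label_def numeral_num_of_nat nat_of_num_numeral[symmetric] nat_of_num_inverse)

type_synonym row = "int \<times> int \<times> int \<times> int"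

fun column :: "row option \<Rightarrow> letter \<Rightarrow> num option" where
  "column None c = None"
| "column (Some (i, j, k, l)) c = label (if fst c then (if snd c then l else k) else (if snd c then j else i))"

text \<open>
  A table is a partial deterministic automaton over the letters of the tape. Its rows list the
  successors under \<open>(False, False)\<close>, \<open>(False, True)\<close>, \<open>(True, False)\<close> and \<open>(True, True)\<close>.
\<close>

definition move :: "row tree \<Rightarrow> num \<Rightarrow> letter \<Rightarrow> num option" where
  "move T p c = column (node_at T p) c"

fun moves :: "row tree \<Rightarrow> num option \<Rightarrow> letter list \<Rightarrow> num option" where
  "moves T None cs = None"
| "moves T (Some p) [] = Some p"
| "moves T (Some p) (c # cs) = moves T (move T p c) cs"

text \<open>
  The machine is run together with two copies of the automaton: \<open>ahead\<close> has read the tape up to the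
  last letter that the machine has read, \<open>behind\<close> up to the last letter that the machine has written.
\<close>

datatype state = State core (ahead: num) (behind: num)

text \<open>
  Between two reading steps the machine is deterministic. Running it until it asks for a letter leaves
  only the reading states to be stored. The natural number bounds the length of such a run.
\<close>

fun settle :: "row tree \<Rightarrow> nat \<Rightarrow> core \<Rightarrow> num \<Rightarrow> num option \<Rightarrow> (letter list \<times> core) outcome \<Rightarrow> state option" where
  "settle T 0 x e p r = None"
| "settle T (Suc k) x e None r = None"
| "settle T (Suc k) x e (Some p) Bad = None"
| "settle T (Suc k) x e (Some p) Read = Some (State x e p)"
| "settle T (Suc k) x e (Some p) (Ok (cs, y)) = settle T k y e (moves T (Some p) cs) (guarded_advance y)"

fun extend :: "core \<Rightarrow> letter \<Rightarrow> core" where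
  "extend (Core s R D S w as bs) c = Core s R D S (w @ [c]) as bs"

definition settle_core :: "row tree \<Rightarrow> core \<Rightarrow> num \<Rightarrow> num \<Rightarrow> state option" where
  "settle_core T x e p = settle T 20 x e (Some p) (guarded_advance x)"

fun read_letter :: "row tree \<Rightarrow> core \<Rightarrow> num \<Rightarrow> letter \<Rightarrow> num option \<Rightarrow> state option list" where
  "read_letter T x p c None = []"
| "read_letter T x p c (Some e) = [settle_core T (extend x c) e p]"

text \<open>
  The letter that is read is not known, but it has to be one that the automaton \<open>ahead\<close> admits.
\<close>

fun successors :: "row tree \<Rightarrow> state \<Rightarrow> state option list" where
  "successors T (State x e p) =
     read_letter T x p (False, False) (move T e (False, False)) @
     read_letter T x p (False, True) (move T e (False, True)) @
     read_letter T x p (True, False) (move T e (True, False)) @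
     read_letter T x p (True, True) (move T e (True, True))"

text \<open>
  A depth-first search with a list of states to be visited and a tree of the states already visited,
  stored according to the automaton state \<open>behind\<close>.
\<close>

datatype search = Failed | Search "state list" "state list tree"

fun occurs :: "state \<Rightarrow> state list option \<Rightarrow> bool" where
  "occurs x None = False"
| "occurs x (Some ys) = (x \<in> set ys)"

fun push :: "state option list \<Rightarrow> state list \<Rightarrow> state list tree \<Rightarrow> search" where
  "push [] xs V = Search xs V"
| "push (None # ys) xs V = Failed"
| "push (Some y # ys) xs V = push ys (y # xs) V"

fun visit :: "row tree \<Rightarrow> bool \<Rightarrow> state \<Rightarrow> state list \<Rightarrow> state list tree \<Rightarrow> search" where
  "visit T True x xs V = Search xs V"
| "visit T False x xs V = push (successors T x) xs (insert_at (behind x) x V)"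

fun explore :: "row tree \<Rightarrow> search \<Rightarrow> search" where
  "explore T Failed = Failed"
| "explore T (Search [] V) = Search [] V"
| "explore T (Search (x # xs) V) = visit T (occurs x (node_at V (behind x))) x xs V"

text \<open>
  This performs \<open>2 ^ n\<close> steps of the search without a large unary numeral.
\<close>

fun iterate :: "nat \<Rightarrow> row tree \<Rightarrow> search \<Rightarrow> search" where
  "iterate 0 T x = explore T x"
| "iterate (Suc n) T x = iterate n T (iterate n T x)"



fun finished :: "search \<Rightarrow> bool" where
  "finished Failed = False"
| "finished (Search xs V) = (xs = [])"

section \<open>A finished search controls all columns\<close>

fun entries :: "'a list tree \<Rightarrow> 'a set" where
  "entries Leaf = {}"
| "entries (Node xs l r) = set xs \<union> entries l \<union> entries r"

lemma entries_insert_at: "entries (insert_at k x V) = insert x (entries V)"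
  by (induction k x V rule: insert_at.induct) auto

lemma node_at_entries: "node_at V k = Some ys \<Longrightarrow> set ys \<subseteq> entries V"
  by (induction V k rule: node_at.induct) auto

lemma occurs_entries: "occurs x (node_at V k) \<Longrightarrow> x \<in> entries V"
  using node_at_entries by (cases "node_at V k") fastforce+

fun sound :: "row tree \<Rightarrow> state option \<Rightarrow> search \<Rightarrow> bool" where
  "sound T x0 Failed = True"
| "sound T x0 (Search xs V) \<longleftrightarrow> x0 \<in> Some ` (entries V \<union> set xs) \<and>
     (\<forall>y\<in>entries V. set (successors T y) \<subseteq> Some ` (entries V \<union> set xs))"

lemma push_eq: "push ys xs V = Search zs V' \<Longrightarrow> V' = V \<and> Some ` set zs = set ys \<union> Some ` set xs"
  by (induction ys xs V arbitrary: zs V' rule: push.induct) auto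

lemma sound_explore: "sound T x0 s \<Longrightarrow> sound T x0 (explore T s)"
proof (induction T s rule: explore.induct)
  case (3 T x xs V)
  show ?case
  proof (cases "occurs x (node_at V (behind x))")
    case True
    then show ?thesis
      using 3 occurs_entries[OF True] by (auto simp: insert_absorb)
  next
    case False
    show ?thesis
    proof (cases "push (successors T x) xs (insert_at (behind x) x V)")
      case Failed
      then show ?thesis
        using False by simp
    next
      case (Search zs W)
      then have "W = insert_at (behind x) x V" "Some ` set zs = set (successors T x) \<union> Some ` set xs"
        using push_eq by blast+
      then show ?thesis
        using 3 False Search by (simp add: entries_insert_at image_Un) blast
    qed
  qed
qed auto

lemma sound_iterate: "sound T x0 s \<Longrightarrow> sound T x0 (iterate n T s)"
  by (induction n arbitrary: s) (auto simp: sound_explore)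

lemma sound_start: "sound T x0 (push [x0] [] Leaf)"
  by (cases x0) auto

text \<open>
  A core that settles in a known reading state.
\<close>

definition good :: "row tree \<Rightarrow> state set \<Rightarrow> core \<Rightarrow> num \<Rightarrow> num \<Rightarrow> bool" where
  "good T X x e p \<longleftrightarrow> (\<exists>k y. settle T k x e (Some p) (guarded_advance x) = Some y \<and> y \<in> X)"

lemma good_cases:
  assumes "good T X x e p"
  shows "(guarded_advance x = Read \<and> State x e p \<in> X) \<or>
    (\<exists>cs y p'. guarded_advance x = Ok (cs, y) \<and> moves T (Some p) cs = Some p' \<and> good T X y e p')"
proof -
  obtain k y where ky: "settle T k x e (Some p) (guarded_advance x) = Some y" "y \<in> X"
    using assms unfolding good_def by blast
  then obtain j where k: "k = Suc j"
    by (cases k) auto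
  show ?thesis
  proof (cases "guarded_advance x")
    case (Ok a)
    obtain cs z where a: "a = (cs, z)"
      by (cases a)
    have st: "settle T j z e (moves T (Some p) cs) (guarded_advance z) = Some y"
      using ky(1) by (simp add: k Ok a)
    then obtain p' where "moves T (Some p) cs = Some p'"
      by (cases j; cases "moves T (Some p) cs") auto
    then show ?thesis
      using st ky(2) Ok a unfolding good_def by auto
  qed (use ky k in auto)
qed

definition closed_under_reading :: "row tree \<Rightarrow> state set \<Rightarrow> bool" where
  "closed_under_reading T X \<longleftrightarrow>
     (\<forall>x e p c e'. State x e p \<in> X \<longrightarrow> move T e c = Some e' \<longrightarrow> good T X (extend x c) e' p)"

lemma read_letter_successor:
  "move T e c = Some e' \<Longrightarrow> settle_core T (extend x c) e' p \<in> set (successors T (State x e p))"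
  by (cases c; cases "fst c"; cases "snd c") auto

theorem search_closed:
  assumes "finished (iterate n T (push [settle_core T x e p] [] Leaf))"
  obtains X where "closed_under_reading T X" "good T X x e p"
proof -
  obtain V where V: "iterate n T (push [settle_core T x e p] [] Leaf) = Search [] V"
    using assms by (cases "iterate n T (push [settle_core T x e p] [] Leaf)") auto
  have s: "sound T (settle_core T x e p) (Search [] V)"
    using sound_iterate[OF sound_start, of T "settle_core T x e p" n] unfolding V .
  have "good T (entries V) (extend y c) e' p'"
    if "State y f p' \<in> entries V" "move T f c = Some e'" for y f p' c e'
  proof -
    have "settle_core T (extend y c) e' p' \<in> Some ` entries V"
      using s that(1) read_letter_successor[OF that(2)] by fastforce
    then show ?thesis
      unfolding settle_core_def good_def by force
  qed
  moreover have "good T (entries V) x e p"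
    using s unfolding settle_core_def good_def by force
  ultimately show thesis
    using that[of "entries V"] unfolding closed_under_reading_def by blast
qed

lemma moves_append: "moves T p (cs @ ds) = moves T (moves T p cs) ds"
proof (induction T p cs rule: moves.induct)
  case (1 T cs)
  then show ?case
    by (cases ds) auto
qed auto

lemma moves_Nil [simp]: "moves T p [] = p"
  by (cases p) auto

text \<open>
  The tape is run through the automaton from position \<open>20\<close> on, which is where the machine starts to
  read. In particular, the automaton survives all letters before position \<open>t\<close>.
\<close>

definition matches :: "row tree \<Rightarrow> num \<Rightarrow> nat \<Rightarrow> core \<Rightarrow> num \<Rightarrow> num \<Rightarrow> bool" where
  "matches T e0 n x e p \<longleftrightarrow> (\<exists>m d t. describes n m d t x \<and> 20 \<le> m \<and> 13 \<le> d \<and> 20 \<le> t \<and>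
     moves T (Some e0) (map tape [20..<m + length (window x)]) = Some e \<and>
     moves T (Some e0) (map tape [20..<t]) = Some p)"

lemma advance_Read: "advance (Core s R D S w as bs) = Read \<Longrightarrow> 0 \<le> s"
  by (rule ccontr) (auto simp: advance_def Let_def split: if_splits)

text \<open>
  The letter that the machine asks for was written by the machine itself long ago: the reading position
  \<open>m + length w\<close> is smaller than the writing position \<open>t\<close>. Therefore the automaton \<open>behind\<close> has already
  passed this letter, and the automaton \<open>ahead\<close> admits it.
\<close>

lemma matches_extend:
  assumes "matches T e0 n x e p" "guarded_advance x = Read"
  shows "\<exists>c e'. move T e c = Some e' \<and> matches T e0 n (extend x c) e' p"
proof -
  obtain m d t where *: "describes n m d t x" "20 \<le> m" "13 \<le> d" "20 \<le> t"
    "moves T (Some e0) (map tape [20..<m + length (window x)]) = Some e"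
    "moves T (Some e0) (map tape [20..<t]) = Some p"
    using assms(1) unfolding matches_def by blast
  obtain s R D S w as bs where x: "x = Core s R D S w as bs"
    by (cases x)
  have adv: "advance x = Read" "tame x"
    using assms(2) by (auto simp: guarded_advance_def split: if_splits)
  then have "0 \<le> s"
    using advance_Read by (simp add: x)
  moreover have "length w + length as \<le> 11"
    using adv(2) by (simp add: x tame_def)
  moreover have "int n = int m + int d + s" "t + length as = n"
    using *(1) unfolding x describes.simps by blast+
  (* t + length as = n = m + d + s, where d \<ge> 13, s \<ge> 0 and length w + length as \<le> 11 *)
  ultimately have z: "m + length w < t"
    using *(3) by linarith
  define z where "z = m + length w"
  have "[20..<t] = [20..<z] @ [z] @ [Suc z..<t]"
    using upt_split[of 20 z t] upt_rec[of z t] z *(2) by (simp add: z_def)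
  then have "moves T (Some e0) (map tape [20..<t]) = moves T (moves T (Some e) [tape z]) (map tape [Suc z..<t])"
    using *(5) by (simp add: moves_append x z_def)
  then obtain e' where e': "move T e (tape z) = Some e'"
    using *(6) by (cases "move T e (tape z)") auto
  have "w = tape_word m (length w)"
    using *(1) unfolding x describes.simps by blast
  then have "w @ [tape z] = tape_word m (length (w @ [tape z]))"
    by (simp add: z_def)
  then have "describes n m d t (extend x (tape z))"
    using *(1) unfolding x extend.simps describes.simps by blast
  moreover have "moves T (Some e0) (map tape [20..<m + length (window (extend x (tape z)))]) = Some e'"
    using *(2,5) e' by (simp add: x z_def moves_append)
  ultimately show ?thesis
    using *(2,3,4,6) e' unfolding matches_def by blast
qed

lemma length_window_extend [simp]: "length (window (extend x c)) = Suc (length (window x))"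
  by (cases x) simp

lemma tame_window: "tame x \<Longrightarrow> length (window x) \<le> 11"
  by (cases x) (simp add: tame_def)

lemma good_advance:
  assumes "closed_under_reading T X" "good T X x e p" "matches T e0 n x e p"
  shows "\<exists>x e p cs y p'. matches T e0 n x e p \<and> guarded_advance x = Ok (cs, y) \<and>
           moves T (Some p) cs = Some p' \<and> good T X y e p'"
  using assms(2,3)
proof (induction "12 - length (window x)" arbitrary: x e rule: less_induct)
  case (less x e)
  show ?case
  proof (cases "guarded_advance x = Read")
    case True
    then have "State x e p \<in> X"
      using good_cases[OF less.prems(1)] by auto
    obtain c e' where c: "move T e c = Some e'" "matches T e0 n (extend x c) e' p"
      using matches_extend[OF less.prems(2) True] by blast
    have "good T X (extend x c) e' p"
      using assms(1) \<open>State x e p \<in> X\<close> c(1) unfolding closed_under_reading_def by blast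
    moreover have "tame x"
      using True by (auto simp: guarded_advance_def split: if_splits)
    ultimately show ?thesis
      using less.hyps[of "extend x c" e'] c(2) tame_window[of x] by fastforce
  next
    case False
    then show ?thesis
      using good_cases[OF less.prems(1)] less.prems(2) by blast
  qed
qed

lemma matches_advance:
  assumes "matches T e0 n x e p" "guarded_advance x = Ok (cs, y)" "moves T (Some p) cs = Some p'"
  shows "matches T e0 (Suc n) y e p'"
proof -
  obtain m d t where *: "describes n m d t x" "20 \<le> m" "13 \<le> d" "20 \<le> t"
    "moves T (Some e0) (map tape [20..<m + length (window x)]) = Some e"
    "moves T (Some e0) (map tape [20..<t]) = Some p"
    using assms(1) unfolding matches_def by blast
  have "advance x = Ok (cs, y)"
    using assms(2) by (auto simp: guarded_advance_def split: if_splits)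
  moreover have "0 < d"
    using *(3) by simp
  ultimately obtain m' d' t' where y: "describes (Suc n) m' d' t' y" "m \<le> m'" "d \<le> d'" "t' = t + length cs"
    "cs = tape_word t (length cs)" "m' + length (window y) = m + length (window x)"
    using advance_describes(1)[OF *(1)] by blast
  have "map tape [20..<t'] = map tape [20..<t] @ cs"
    unfolding y(4) using upt_split[of 20 t "t + length cs"] *(4) y(5) by simp
  then have "moves T (Some e0) (map tape [20..<t']) = Some p'"
    using *(6) assms(3) by (simp add: moves_append)
  moreover have "20 \<le> m'" "13 \<le> d'" "20 \<le> t'"
    using *(2-4) y(2-4) by simp_all
  ultimately show ?thesis
    using y(1) *(5) unfolding matches_def y(6)[symmetric] by blast
qed

lemma matches_controlled:
  assumes "matches T e0 n x e p" "guarded_advance x = Ok (cs, y)"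
  shows "controlled n"
proof -
  have "advance x = Ok (cs, y)" "tame x"
    using assms(2) by (auto simp: guarded_advance_def split: if_splits)
  then show ?thesis
    using assms(1) unfolding matches_def controlled_def by blast
qed

theorem all_controlled:
  assumes "closed_under_reading T X" "good T X x0 e0 p0" "matches T e0 k x0 e0 p0" "k \<le> n"
  shows "controlled n"
proof -
  have "\<exists>x e p. good T X x e p \<and> matches T e0 n x e p"
    using assms(4)
  proof (induction n rule: dec_induct)
    case base
    then show ?case
      using assms(2,3) by blast
  next
    case (step n)
    then show ?case
      using good_advance[OF assms(1)] matches_advance by meson
  qed
  then show ?thesis
    using good_advance[OF assms(1)] matches_controlled by meson
qed

section \<open>The first columns\<close>

definition attacks :: "int \<Rightarrow> int \<Rightarrow> int \<times> int \<Rightarrow> bool" where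
  "attacks n y p \<longleftrightarrow> y = snd p \<or> y - n = snd p - fst p \<or> y + n = snd p + fst p"

lemma attacks_int:
  "attacks (int n) (int y) (int i, int z) \<longleftrightarrow> y = z \<or> int y - int n = int z - int i \<or> y + n = z + i"
proof -
  have "int y + int n = int z + int i \<longleftrightarrow> y + n = z + i"
    by linarith
  then show ?thesis
    by (simp add: attacks_def)
qed

text \<open>
  The greedy rule on lists of squares. By \<open>queen_trichotomy\<close> only squares below the diagonal have to be
  tried. Integers are used since binary arithmetic keeps the evaluation by rewriting short.
\<close>

fun first_queens :: "nat \<Rightarrow> (int \<times> int) list" where
  "first_queens 0 = [(0, 0)]"
| "first_queens (Suc k) =
     (let ps = first_queens k; n = int (Suc k) in
      (n, case List.find (\<lambda>y. \<not> list_ex (attacks n y) ps) (map int [0..<Suc k]) of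
            Some y \<Rightarrow> y
          | None \<Rightarrow> n + int (length (filter (\<lambda>p. fst p < snd p) ps)) + 1) # ps)"

lemma first_queens_eq: "first_queens k = map (\<lambda>i. (int i, int (q i))) (rev [0..<Suc k])"
proof (induction k)
  case (Suc k)
  define n where "n = Suc k"
  define ps where "ps = first_queens k"
  have ps: "ps = map (\<lambda>i. (int i, int (q i))) (rev [0..<n])"
    unfolding ps_def n_def by (rule Suc.IH)
  have free: "\<not> list_ex (attacks (int n) (int y)) ps \<longleftrightarrow> free n y" for y
    unfolding ps list_ex_iff free_def by (auto simp: attacks_int simp del: upt_Suc)
  have "length (filter (\<lambda>p. fst p < snd p) ps) = length (filter upper [0..<n])"
    by (simp add: ps filter_map comp_def upper_def[abs_def] rev_filter[symmetric] del: upt_Suc)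
  also have "\<dots> = uppers n"
    by (simp add: uppers_def length_filter_conv_card cong: conj_cong)
  finally have count: "length (filter (\<lambda>p. fst p < snd p) ps) = uppers n" .
  have "(case List.find (\<lambda>y. \<not> list_ex (attacks (int n) y) ps) (map int [0..<n]) of
            Some y \<Rightarrow> y | None \<Rightarrow> int n + int (uppers n) + 1) = int (q n)"
  proof (cases "List.find (\<lambda>y. \<not> list_ex (attacks (int n) y) ps) (map int [0..<n])")
    case None
    have "\<not> free n y" if "y < n" for y
      using None that free[of y] unfolding find_None_iff by auto
    then have "upper n"
      by (simp add: upper_iff n_def)
    then show ?thesis
      using None upper_queen by simp
  next
    case (Some y)
    then obtain i where i: "i < n" "y = int i" "free n i" "\<And>j. j < i \<Longrightarrow> \<not> free n j"
      by (auto simp: find_Some_iff free[symmetric])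
    then show ?thesis
      using Some lower_queen_eqI(2) by simp
  qed
  then have "first_queens (Suc k) = (int n, int (q n)) # ps"
    unfolding first_queens.simps Let_def unfolding ps_def[symmetric] n_def[symmetric] count by simp
  then show ?case
    by (simp add: ps n_def)
qed auto

lemma first_queens_30: "map snd (rev (first_queens 30)) = [0, 2, 4, 1, 3, 8, 10, 12, 14, 5, 7, 18, 6, 21, 9, 24, 26, 28, 30, 11, 13, 34, 36, 38, 40, 15, 17, 44, 16, 47, 19]"
  by code_simp

lemma queens_below_31: "map q [0..<31] = [0, 2, 4, 1, 3, 8, 10, 12, 14, 5, 7, 18, 6, 21, 9, 24, 26, 28, 30, 11, 13, 34, 36, 38, 40, 15, 17, 44, 16, 47, 19]"
proof -
  have "map int (map q [0..<31]) = map snd (rev (first_queens 30))"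
    unfolding first_queens_eq by (simp add: comp_def rev_map[symmetric] del: upt_Suc) 
  also have "\<dots> = map int [0, 2, 4, 1, 3, 8, 10, 12, 14, 5, 7, 18, 6, 21, 9, 24, 26, 28, 30, 11, 13, 34, 36, 38, 40, 15, 17, 44, 16, 47, 19]"
    unfolding first_queens_30 by simp
  finally show ?thesis
    by (subst (asm) inj_map_eq_map) (auto simp: inj_on_def)
qed

text \<open>
  The situation before column \<open>31\<close>: rows below \<open>20\<close> and diagonals below \<open>13\<close> are full, nothing beyond them
  is occupied, and row \<open>31\<close>, which is not an upper row, waits for its column.
\<close>

definition core31 :: core where
  "core31 = Core (- 2) [] [] [] [] [] [False]"

lemma queens_with_columns: "map (\<lambda>c. (c, q c)) [0..<31] = [(0, 0), (1, 2), (2, 4), (3, 1), (4, 3), (5, 8), (6, 10), (7, 12), (8, 14), (9, 5), (10, 7), (11, 18), (12, 6), (13, 21), (14, 9), (15, 24), (16, 26), (17, 28), (18, 30), (19, 11), (20, 13), (21, 34), (22, 36), (23, 38), (24, 40), (25, 15), (26, 17), (27, 44), (28, 16), (29, 47), (30, 19)]"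
proof -
  have "map (\<lambda>c. (c, q c)) [0..<31] = zip [0..<31] (map q [0..<31])"
    by (simp add: zip_map2 zip_same_conv_map comp_def del: upt_Suc)
  also have "\<dots> = [(0, 0), (1, 2), (2, 4), (3, 1), (4, 3), (5, 8), (6, 10), (7, 12), (8, 14), (9, 5), (10, 7), (11, 18), (12, 6), (13, 21), (14, 9), (15, 24), (16, 26), (17, 28), (18, 30), (19, 11), (20, 13), (21, 34), (22, 36), (23, 38), (24, 40), (25, 15), (26, 17), (27, 44), (28, 16), (29, 47), (30, 19)]"
    unfolding queens_below_31 by code_simp
  finally show ?thesis .
qed

lemma ex_below_31: "(\<exists>c<31. Q c (q c)) \<longleftrightarrow> (\<exists>p\<in>set [(0, 0), (1, 2), (2, 4), (3, 1), (4, 3), (5, 8), (6, 10), (7, 12), (8, 14), (9, 5), (10, 7), (11, 18), (12, 6), (13, 21), (14, 9), (15, 24), (16, 26), (17, 28), (18, 30), (19, 11), (20, 13), (21, 34), (22, 36), (23, 38), (24, 40), (25, 15), (26, 17), (27, 44), (28, 16), (29, 47), (30, 19)]. Q (fst p) (snd p))"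
  unfolding queens_with_columns[symmetric] by auto

lemma all_below_31: "(\<forall>c<31. Q c (q c)) \<longleftrightarrow> (\<forall>p\<in>set [(0, 0), (1, 2), (2, 4), (3, 1), (4, 3), (5, 8), (6, 10), (7, 12), (8, 14), (9, 5), (10, 7), (11, 18), (12, 6), (13, 21), (14, 9), (15, 24), (16, 26), (17, 28), (18, 30), (19, 11), (20, 13), (21, 34), (22, 36), (23, 38), (24, 40), (25, 15), (26, 17), (27, 44), (28, 16), (29, 47), (30, 19)]. Q (fst p) (snd p))"
  unfolding queens_with_columns[symmetric] by auto

lemma lower_row_31: "lower_row 31 r \<longleftrightarrow> r \<in> {0, 1, 3, 5, 7, 6, 9, 11, 13, 15, 17, 16, 19}"
  unfolding lower_row_def upper_def ex_below_31[of "\<lambda>c z. \<not> c < z \<and> z = r"] by auto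

lemma lower_diag_31: "lower_diag 31 d \<longleftrightarrow> d < 13"
proof -
  have "lower_diag 31 d \<longleftrightarrow> d \<in> {0, 2, 1, 4, 3, 6, 5, 8, 7, 10, 9, 12, 11}"
    unfolding lower_diag_def upper_def ex_below_31[of "\<lambda>c z. \<not> c < z \<and> z + d = c"] by auto
  also have "\<dots> \<longleftrightarrow> d < 13"
    by (simp, arith)
  finally show ?thesis .
qed

lemma lower_sum_31: "lower_sum 31 z \<Longrightarrow> z < 51"
  unfolding lower_sum_def upper_def ex_below_31[of "\<lambda>c y. \<not> c < y \<and> y + c = z"] by auto

lemma upper_31: "\<forall>c<31. upper c \<longleftrightarrow> c \<in> {1, 2, 5, 6, 7, 8, 11, 13, 15, 16, 17, 18, 21, 22, 23, 24, 27, 29}"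
  unfolding upper_def all_below_31[of "\<lambda>c z. c < z \<longleftrightarrow> c \<in> {1, 2, 5, 6, 7, 8, 11, 13, 15, 16, 17, 18, 21, 22, 23, 24, 27, 29}"] by simp

lemma upper_row_31:
  assumes "r \<le> 31"
  shows "upper_row r \<longleftrightarrow> r \<in> {2, 4, 8, 10, 12, 14, 18, 21, 24, 26, 28, 30}"
proof -
  have "a < 31" if "a < q a" "q a = r" for a
    using that assms by simp
  then have "upper_row r \<longleftrightarrow> (\<exists>a<31. a < q a \<and> q a = r)"
    unfolding upper_row_def upper_def by blast
  then show ?thesis
    using assms unfolding ex_below_31[of "\<lambda>c z. c < z \<and> z = r"] by auto
qed

lemma uppers_20: "uppers 20 = 12"
proof -
  have "{a. a < 20 \<and> upper a} = {1, 2, 5, 6, 7, 8, 11, 13, 15, 16, 17, 18}"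
    using upper_31 by auto
  then show ?thesis
    by (simp add: uppers_def)
qed

lemma describes_31: "describes 31 20 13 31 core31"
proof -
  have "upper_row r \<or> lower_row 31 r" if "r < 20" for r
  proof -
    have "\<forall>r<20. r \<in> {2, 4, 8, 10, 12, 14, 18, 21, 24, 26, 28, 30} \<or>
        r \<in> {0, 1, 3, 5, 7, 6, 9, 11, 13, 15, 17, 16, 19 :: nat}"
      by code_simp
    then show ?thesis
      using that upper_row_31[of r] lower_row_31[of r] by simp
  qed
  moreover have "\<not> lower_sum 31 (31 + 20 + i)" for i
    using lower_sum_31 by force
  moreover have "[31..<20 + uppers 20] = [31]"
    by (simp add: uppers_20 upt_rec_numeral)
  ultimately show ?thesis
    unfolding core31_def describes.simps using upper_row_31[of 31]
    by (simp add: lower_row_31 lower_diag_31 uppers_20)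
qed

lemma tape_20_31: "map tape [20..<31] = [(False, False), (True, True), (True, False), (True, False), (True, True), (False, False), (False, True), (True, False), (False, True), (True, False), (False, True)]"
  using upper_31 upper_row_31 by (simp add: upt_rec_numeral tape_def)

text \<open>
  The decimal bounds on \<open>\<phi>\<close> leave \<open>n * \<phi>\<close> uncertain by at most \<open>0.003\<close> in these columns, and
  \<open>3.003 < 5 / \<phi>\<close>.
\<close>

lemma small_uppers: "upper n \<Longrightarrow> n < 31 \<Longrightarrow> \<bar>offset n\<bar> < 5 * (golden_ratio - 1)"
proof -
  assume n: "upper n" "n < 31"
  have "\<forall>c<31. c < q c \<longrightarrow> \<bar>1000 * int (q c) - 1618 * int c\<bar> \<le> 3000"
    unfolding all_below_31[of "\<lambda>c z. c < z \<longrightarrow> \<bar>1000 * int z - 1618 * int c\<bar> \<le> 3000"] by simp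
  then have "\<bar>1000 * int (q n) - 1618 * int n\<bar> \<le> 3000"
    using n by (simp add: upper_def)
  then have "\<bar>1000 * real (q n) - 1618 * real n\<bar> \<le> 3000"
    by linarith
  moreover have "real n \<le> 30"
    using n by simp
  moreover have "real n * (1618 / 1000) \<le> real n * golden_ratio" "real n * golden_ratio \<le> real n * (16181 / 10000)"
    using golden(2,3) by (intro mult_left_mono; simp)+
  ultimately show ?thesis
    using golden(2) n(2) unfolding upper_offset[OF n(1), symmetric] abs_le_iff abs_less_iff
    by (simp add: algebra_simps)
qed

lemma small_lowers:
  assumes "\<not> upper n" "n < 31"
  shows "\<bar>real (q n) - real n * (golden_ratio - 1)\<bar> < 4 + 5 * (golden_ratio - 1)"
proof -
  have "\<forall>c<31. \<not> c < q c \<longrightarrow> \<bar>1000 * int (q c) - 618 * int c\<bar> \<le> 7000"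
    unfolding all_below_31[of "\<lambda>c z. \<not> c < z \<longrightarrow> \<bar>1000 * int z - 618 * int c\<bar> \<le> 7000"] by simp
  then have "\<bar>1000 * int (q n) - 618 * int n\<bar> \<le> 7000"
    using assms by (simp add: upper_def)
  then have "\<bar>1000 * real (q n) - 618 * real n\<bar> \<le> 7000"
    by linarith
  moreover have "real n \<le> 30"
    using assms by simp
  moreover have "real n * (618 / 1000) \<le> real n * (golden_ratio - 1)"
    "real n * (golden_ratio - 1) \<le> real n * (6181 / 10000)"
    using golden(2,3) by (intro mult_left_mono; simp)+
  ultimately show ?thesis
    using golden(2) assms(2) unfolding abs_le_iff abs_less_iff by (simp add: algebra_simps)
qed

section \<open>The automaton and the theorem\<close>

text \<open>
  The table was found by computer: one starts with the words of length \<open>13\<close> that occur in the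
  tape, adds the words that the machine can write while it reads such words until nothing new appears,
  and merges states as long as the machine stays in the range above. Only the success of the search
  below matters, not how the table came about.
\<close>

definition rows :: "row list" where
  "rows =
   [(2,3,4,5), (0,0,0,6), (0,0,7,0), (8,9,0,0), (10,0,0,0), (0,0,11,0), (12,13,0,0), (0,0,0,14),
    (15,0,16,0), (0,17,0,18), (19,20,21,22), (0,0,0,23), (0,0,24,0), (25,0,26,0), (0,0,27,0),
    (0,28,29,30), (0,0,31,0), (32,0,0,0), (0,0,33,34), (35,0,36,0), (37,0,38,39), (40,0,0,0),
    (41,0,0,0), (0,42,0,0), (0,0,0,43), (0,0,0,44), (0,45,0,0), (46,0,0,0), (0,47,0,0), (48,0,0,0),
    (49,13,0,0), (50,0,0,0), (0,51,0,52), (53,0,54,0), (0,0,55,56), (57,0,58,0), (0,0,0,59), (0,0,0,60),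
    (61,0,0,0), (62,63,64,5), (0,0,65,43), (0,0,66,0), (0,0,67,0), (68,0,0,0), (0,0,69,0), (0,0,0,70),
    (71,0,72,0), (73,0,74,75), (0,0,76,77), (0,0,78,79), (0,0,80,0), (81,0,82,0), (0,83,0,0),
    (84,0,0,85), (0,0,0,86), (87,0,88,0), (0,0,0,89), (8,90,38,91), (92,0,93,0), (1,0,0,0),
    (2,94,95,96), (0,0,97,98), (0,0,99,0), (100,101,38,102), (0,0,0,103), (0,0,104,0), (105,0,0,106),
    (62,63,107,5), (0,0,0,108), (109,0,110,0), (0,0,0,111), (0,112,0,0), (0,113,0,98), (100,114,0,102),
    (115,0,0,0), (0,0,0,116), (0,0,117,0), (0,0,0,118), (0,0,119,0), (0,0,0,120), (0,0,0,121),
    (0,0,122,123), (0,0,124,0), (0,0,0,125), (126,0,0,0), (81,0,0,0), (0,0,0,127), (0,128,0,0),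
    (0,0,129,0), (0,0,130,0), (131,0,0,0), (0,0,132,43), (133,0,0,44), (0,0,134,0), (8,135,38,136),
    (137,0,0,0), (0,0,0,138), (0,0,139,0), (140,13,141,0), (0,0,55,14), (0,0,142,0), (143,0,0,0),
    (0,0,144,0), (145,0,38,146), (0,0,0,147), (148,0,0,0), (0,101,0,0), (0,0,149,0), (0,0,150,0),
    (0,0,21,0), (0,0,151,0), (152,0,0,0), (0,0,153,0), (154,0,155,0), (0,156,0,18), (81,0,144,0),
    (157,0,158,159), (160,0,161,0), (19,20,162,163), (164,0,149,0), (0,0,165,0), (0,0,0,166),
    (167,0,0,0), (0,0,168,108), (0,0,169,0), (62,170,171,5), (0,0,172,0), (0,0,36,0), (157,0,173,163),
    (0,0,174,0), (175,176,95,5), (0,0,0,177), (0,0,0,178), (133,13,179,0), (0,0,16,0), (180,0,0,0),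
    (0,17,0,0), (181,0,182,0), (19,20,21,163), (0,0,0,183), (8,0,38,91), (184,28,29,30),
    (62,185,186,75), (0,0,0,123), (0,0,0,187), (188,0,0,0), (25,0,189,0), (0,185,190,96), (191,0,0,22),
    (0,0,0,192), (0,193,0,0), (0,0,53,0), (0,0,0,194), (0,0,0,195), (184,196,197,30), (0,0,198,0),
    (0,0,0,199), (200,0,0,201), (202,0,0,0), (0,0,76,203), (204,0,122,123), (37,0,38,205), (206,0,0,0),
    (0,0,0,207), (133,0,0,208), (209,0,0,0), (62,63,210,5), (0,0,0,211), (0,0,0,212), (0,0,213,0),
    (0,135,0,0), (105,0,214,106), (0,0,0,215), (0,0,38,0), (0,0,216,6), (0,0,217,0), (218,0,0,0),
    (25,0,54,0), (100,0,38,91), (0,0,219,0), (0,0,76,121), (191,0,0,123), (220,0,0,0), (221,113,0,0),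
    (0,0,222,0), (8,223,38,224), (0,0,26,0), (175,0,95,0), (225,0,0,85), (8,226,38,224), (0,0,0,227),
    (218,0,161,0), (0,0,228,0), (229,0,149,0), (230,0,0,0), (231,0,0,0), (0,232,0,0), (233,13,0,0),
    (0,0,234,0), (0,0,0,235), (236,0,0,0), (62,63,237,5), (238,0,165,0), (0,0,0,239), (240,0,0,0),
    (62,63,241,5), (0,0,242,0), (243,0,0,0), (2,0,0,0), (0,244,38,102), (0,0,82,0), (245,0,0,0),
    (0,13,141,0), (0,0,0,246), (247,0,0,0), (0,0,0,248), (133,13,141,0), (0,0,76,249), (8,223,38,0),
    (0,0,76,43), (0,0,0,250), (0,0,141,0), (0,0,155,0), (251,0,0,0), (0,0,0,252), (0,0,253,0),
    (0,0,54,0), (57,0,254,0), (0,0,150,207), (0,0,0,255), (0,0,0,256), (71,0,257,0), (0,0,258,77),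
    (84,0,259,212), (260,0,0,0), (261,262,0,263), (0,101,0,224), (0,0,0,264), (265,0,266,0),
    (267,94,95,96), (100,101,268,102), (105,0,269,208), (0,185,270,96), (15,0,271,0), (62,170,171,0),
    (272,0,0,0), (261,262,0,273), (218,0,274,0), (275,0,165,0), (0,0,276,0), (62,0,186,75),
    (277,0,278,0), (0,28,279,30), (8,90,38,0), (0,0,280,0), (109,0,139,0), (0,112,0,281), (0,45,0,116),
    (282,0,0,0), (0,0,132,283), (0,0,284,0), (0,0,285,0), (286,0,0,0), (287,0,288,0), (0,0,0,289),
    (225,0,290,85), (0,0,291,6), (145,0,0,0), (0,0,38,246), (8,135,38,102), (184,28,197,30),
    (0,292,0,0), (293,0,0,0), (191,0,0,294), (0,0,0,295), (0,0,0,296), (0,0,0,297), (298,0,0,212),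
    (0,299,0,0), (300,0,214,106), (301,0,0,0), (0,0,0,302), (275,0,67,0), (0,0,0,303), (0,0,179,0),
    (0,0,304,0), (0,0,305,0), (306,307,0,106), (0,0,308,0), (0,0,0,201), (0,0,0,309), (0,0,310,0),
    (0,0,311,0), (312,0,0,0), (0,0,288,0), (229,0,313,0), (0,0,314,0), (0,0,0,315), (0,0,72,0),
    (0,0,316,317), (0,209,74,75), (318,0,0,0), (0,0,319,0), (0,320,321,0), (0,0,0,322), (0,0,316,178),
    (0,0,323,0), (105,0,0,0), (218,0,319,0), (0,13,179,0), (0,320,0,0), (0,63,0,5), (324,0,122,123),
    (0,0,0,325), (326,0,169,0), (0,0,0,52), (25,0,266,0), (0,0,0,283), (133,0,0,294), (327,0,0,0),
    (0,328,0,0), (329,0,0,0), (0,0,330,0), (0,0,0,317), (331,0,0,0), (0,0,0,332), (0,0,333,0),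
    (334,0,0,0), (0,0,65,249), (335,262,38,91), (0,185,0,0), (0,0,336,0), (0,0,337,0), (0,0,0,338),
    (0,0,0,339), (105,0,0,325), (0,0,0,340), (0,0,341,0), (25,0,342,0), (109,0,82,0), (343,193,0,0),
    (225,0,344,44), (0,0,33,345), (0,0,0,346), (347,0,0,0), (348,0,0,0), (0,83,65,127), (349,0,0,263),
    (0,0,284,108)]"

text \<open>
  Reading only words that the automaton admits, the machine writes only words that the automaton
  admits, and it never leaves the range.
\<close>

lemma search_finished:
  "finished (iterate 12 (tree_of rows) (push [settle_core (tree_of rows) core31 (the (label 1)) (the (label 42))] [] Leaf))"
  by code_simp

text \<open>
  The letters at positions \<open>20\<close> to \<open>30\<close>, which are complete when column \<open>31\<close> is played, put the automaton
  \<open>behind\<close> into state \<open>42\<close>.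
\<close>

lemma word31: "moves (tree_of rows) (Some (the (label 1))) [(False, False), (True, True), (True, False), (True, False), (True, True), (False, False), (False, True), (True, False), (False, True), (True, False), (False, True)] = Some (the (label 42))"
  by code_simp

theorem theorem1:
  fixes n :: nat
  assumes "n \<ge> 1"
  shows "(greedy_queens n > n \<longrightarrow>
            \<bar>real (greedy_queens n) - real n * golden_ratio\<bar> < 5 / golden_ratio) \<and>
         (greedy_queens n < n \<longrightarrow>
            \<bar>real (greedy_queens n) - real n / golden_ratio\<bar> < 4 + 5 / golden_ratio)"
proof -
  obtain X where X: "closed_under_reading (tree_of rows) X"
    "good (tree_of rows) X core31 (the (label 1)) (the (label 42))"
    using search_closed[OF search_finished] .
  have "moves (tree_of rows) (Some (the (label 1))) (map tape [20..<31]) = Some (the (label 42))"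
    unfolding tape_20_31 by (rule word31)
  then have start: "matches (tree_of rows) (the (label 1)) 31 core31 (the (label 1)) (the (label 42))"
    using describes_31 unfolding matches_def
    by (intro exI[of _ 20] exI[of _ 13] exI[of _ 31]) (simp add: core31_def del: upt_rec_numeral)
  have controlled: "controlled k" if "31 \<le> k" for k
    using all_controlled[OF X start that] .
  have div: "x / golden_ratio = x * (golden_ratio - 1)" for x
    using golden(4) by (metis times_divide_eq_right mult.right_neutral)
  have "q 8 = 14"
    using all_below_31[of "\<lambda>c z. c = 8 \<longrightarrow> z = 14"] by simp
  then have 8: "upper 8" "q 8 < 20"
    by (simp_all add: upper_def)
  show ?thesis
  proof (intro conjI impI)
    assume "n < q n"
    then have "upper n"
      by (simp add: upper_def)
    then show "\<bar>real (q n) - real n * golden_ratio\<bar> < 5 / golden_ratio"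
      using offset_bound[OF controlled 8 small_uppers] by (simp only: upper_offset div)
  next
    assume "q n < n"
    then have "\<not> upper n"
      by (simp add: upper_def)
    then show "\<bar>real (q n) - real n / golden_ratio\<bar> < 4 + 5 / golden_ratio"
      using lower_bound[OF controlled 8 small_uppers] small_lowers[of n] unfolding div by (cases "n < 31") auto
  qed
qed

end
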